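(* Let $d_A,d_B\geq 2$ be integers, $d=\min(d_A,d_B)$, let $\alpha,\beta$ be arbitrary real numbers and let $l\geq 1$ be a natural number. For every bipartite state (density matrix) $\rho$ on $\mathbb{C}^{d_A}\otimes\mathbb{C}^{d_B}$, the concurrence satisfies $$C(\rho)\geq\frac{\sqrt{2}}{\sqrt{d(d-1)}}\left(\left\|\mathcal{M}_{\alpha,\beta}^{l}(\rho)\right\|_{tr}-\sqrt{(l\alpha^{2}+1)(l\beta^{2}+1)}\right).$$
   Context: A state on $\mathbb{C}^{d_A}\otimes\mathbb{C}^{d_B}$ is a positive semidefinite $d_Ad_B\times d_Ad_B$ complex matrix of trace $1$. Concurrence: for a pure state (unit vector) $|\varphi\rangle\in\mathbb{C}^{d_A}\otimes\mathbb{C}^{d_B}$, $C(|\varphi\rangle)=\sqrt{2(1-\operatorname{tr}(\rho_A^2))}$ with $\rho_A=\operatorname{tr}_B(|\varphi\rangle\langle\varphi|)$. For a mixed state, $C(\rho)=\min\sum_i p_i C(|\varphi_i\rangle)$, the minimum over all ensemble decompositions $\rho=\sum_i p_i|\varphi_i\rangle\langle\varphi_i|$ with $p_i\geq 0$, $\sum_i p_i=1$, and $|\varphi_i\rangle$ pure states. For $A=[a_{ij}]\in\mathbb{C}^{m\times n}$, $\operatorname{vec}(A)=(a_{11},\dots,a_{m1},a_{12},\dots,a_{m2},\dots,a_{1n},\dots,a_{mn})^T$ (column stacking), $T$ denotes transpose (no conjugation), and $\|A\|_{tr}=\operatorname{tr}\sqrt{A^\dagger A}$ is the trace norm. Realignment: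 if $Z$ is an $m\times m$ block matrix with blocks $Z_{i,j}\in\mathbb{C}^{n\times n}$, then $\mathcal{R}(Z)$ is the $m^2\times n^2$ matrix whose rows are, in order, $\operatorname{vec}(Z_{1,1})^T,\dots,\operatorname{vec}(Z_{m,1})^T,\dots,\operatorname{vec}(Z_{1,m})^T,\dots,\operatorname{vec}(Z_{m,m})^T$. For $\rho$ on $\mathbb{C}^{d_A}\otimes\mathbb{C}^{d_B}$ take $m=d_A$, $n=d_B$. For a matrix $X$, $\omega_l(X)=(\operatorname{vec}(X),\dots,\operatorname{vec}(X))$ is the matrix with $l$ columns all equal to $\operatorname{vec}(X)$. $E_{l\times l}$ is the $l\times l$ matrix with all entries $1$. $\operatorname{tr}_A,\operatorname{tr}_B$ are the partial traces over $A$, $B$. Define $$\mathcal{M}_{\alpha,\beta}^{l}(\rho)=\begin{pmatrix}\alpha\beta E_{l\times l} & \alpha\,\omega_l(\operatorname{tr}_A(\rho))^T\\ \beta\,\omega_l(\operatorname{tr}_B(\rho)) & \mathcal{R}(\rho)\end{pmatrix}\in\mathbb{C}^{(l+d_A^2)\times(l+d_B^2)}.$$ *)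

theory Defs
  imports "Jordan_Normal_Form.Schur_Decomposition"
begin

definition mat_trace :: "complex mat \<Rightarrow> complex" where
  "mat_trace A = (\<Sum>i<dim_row A. A $$ (i, i))"

definition psd_mat :: "nat \<Rightarrow> complex mat \<Rightarrow> bool" where
  "psd_mat n A \<longleftrightarrow> A \<in> carrier_mat n n \<and> mat_adjoint A = A \<and>
     (\<forall>v \<in> carrier_vec n. 0 \<le> Re ((A *\<^sub>v v) \<bullet>c v))"

definition density_mat :: "nat \<Rightarrow> complex mat \<Rightarrow> bool" where
  "density_mat n \<rho> \<longleftrightarrow> psd_mat n \<rho> \<and> mat_trace \<rho> = 1"

text \<open>The positive semidefinite square root; it is the unique one when \<open>A\<close> is
  positive semidefinite, and it is only applied to matrices of that kind.\<close>
definition psd_sqrt :: "complex mat \<Rightarrow> complex mat" where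
  "psd_sqrt A = (THE B. psd_mat (dim_row A) B \<and> B * B = A)"

text \<open>The trace below is real and nonnegative; \<open>Re\<close> only changes the type.\<close>
definition trace_norm :: "complex mat \<Rightarrow> real" where
  "trace_norm A = Re (mat_trace (psd_sqrt (mat_adjoint A * A)))"

text \<open>Column stacking.\<close>
definition vectorize :: "'a mat \<Rightarrow> 'a vec" where
  "vectorize A = vec (dim_row A * dim_col A) (\<lambda>k. A $$ (k mod dim_row A, k div dim_row A))"

definition rep_cols :: "nat \<Rightarrow> 'a mat \<Rightarrow> 'a mat" where
  "rep_cols l X = mat_of_cols (dim_row X * dim_col X) (replicate l (vectorize X))"

text \<open>The \<open>n \<times> n\<close> block at block position \<open>(i, j)\<close> (counted from 0). A matrix on
  \<open>C^m \<otimes> C^n\<close> has rows and columns indexed by \<open>i * n + k\<close>, where \<open>i < m\<close> refers to the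
  first and \<open>k < n\<close> to the second tensor factor.\<close>
definition block :: "nat \<Rightarrow> 'a mat \<Rightarrow> nat \<Rightarrow> nat \<Rightarrow> 'a mat" where
  "block n Z i j = mat n n (\<lambda>(k, k'). Z $$ (i * n + k, j * n + k'))"

text \<open>The blocks are listed down the block columns: row \<open>j * m + i\<close> comes from block
  \<open>(i, j)\<close>.\<close>
definition realign :: "nat \<Rightarrow> nat \<Rightarrow> 'a mat \<Rightarrow> 'a mat" where
  "realign m n Z = mat\<^sub>r (m * m) (n * n) (\<lambda>r. vectorize (block n Z (r mod m) (r div m)))"

definition ptrace_A :: "nat \<Rightarrow> nat \<Rightarrow> complex mat \<Rightarrow> complex mat" where
  "ptrace_A m n \<rho> = mat n n (\<lambda>kk'. \<Sum>i<m. block n \<rho> i i $$ kk')"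

definition ptrace_B :: "nat \<Rightarrow> nat \<Rightarrow> complex mat \<Rightarrow> complex mat" where
  "ptrace_B m n \<rho> = mat m m (\<lambda>(i, j). mat_trace (block n \<rho> i j))"

definition M_mat :: "nat \<Rightarrow> nat \<Rightarrow> nat \<Rightarrow> real \<Rightarrow> real \<Rightarrow> complex mat \<Rightarrow> complex mat" where
  "M_mat m n l \<alpha> \<beta> \<rho> = four_block_mat
     (complex_of_real (\<alpha> * \<beta>) \<cdot>\<^sub>m mat l l (\<lambda>_. 1))
     (complex_of_real \<alpha> \<cdot>\<^sub>m transpose_mat (rep_cols l (ptrace_A m n \<rho>)))
     (complex_of_real \<beta> \<cdot>\<^sub>m rep_cols l (ptrace_B m n \<rho>))
     (realign m n \<rho>)"

definition pure_state :: "nat \<Rightarrow> complex vec \<Rightarrow> bool" where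
  "pure_state n \<phi> \<longleftrightarrow> \<phi> \<in> carrier_vec n \<and> \<phi> \<bullet>c \<phi> = 1"

definition projector :: "complex vec \<Rightarrow> complex mat" where
  "projector \<phi> = mat (dim_vec \<phi>) (dim_vec \<phi>) (\<lambda>(a, b). \<phi> $ a * cnj (\<phi> $ b))"

definition pure_concurrence :: "nat \<Rightarrow> nat \<Rightarrow> complex vec \<Rightarrow> real" where
  "pure_concurrence m n \<phi> =
     (let \<rho>A = ptrace_B m n (projector \<phi>) in sqrt (2 * (1 - Re (mat_trace (\<rho>A * \<rho>A)))))"

definition is_ensemble ::
    "nat \<Rightarrow> complex mat \<Rightarrow> nat \<Rightarrow> (nat \<Rightarrow> real) \<Rightarrow> (nat \<Rightarrow> complex vec) \<Rightarrow> bool" where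
  "is_ensemble N \<rho> r p \<phi> \<longleftrightarrow>
     (\<forall>i<r. 0 \<le> p i \<and> pure_state N (\<phi> i)) \<and> (\<Sum>i<r. p i) = 1 \<and>
     \<rho> = mat N N (\<lambda>ab. \<Sum>i<r. complex_of_real (p i) * projector (\<phi> i) $$ ab)"

text \<open>The minimum over all finite ensembles of any size \<open>r\<close>, taken as the infimum in the
  reals. For a density matrix the set is nonempty and bounded below by 0.\<close>
definition concurrence :: "nat \<Rightarrow> nat \<Rightarrow> complex mat \<Rightarrow> real" where
  "concurrence m n \<rho> =
     Inf {\<Sum>i<r. p i * pure_concurrence m n (\<phi> i) | r p \<phi>. is_ensemble (m * n) \<rho> r p \<phi>}"

end

(* Every matrix occurring here is a sum of rank one matrices x y^T, and the trace norm of such a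
   sum is at most the sum of the |x||y|: pair the matrix with its singular vectors and use the
   Cauchy-Schwarz and Bessel inequalities.

   For a pure state with Schmidt decomposition sum_t s_t e_t (x) g_t, the matrix M is the sum over
   all t, u of s_t s_u x_tu y_tu^T, where x_tu is vec(e_t e_u^H) and, when t = u, is preceded by l
   entries alpha; similarly y_tu with g and beta. Hence
   ||M|| <= sqrt((l alpha^2 + 1)(l beta^2 + 1)) + (sum_t s_t)^2 - 1, and Cauchy-Schwarz over the
   d(d-1) pairs t ~= u bounds (sum_t s_t)^2 - 1 by sqrt(d(d-1)/2) times the concurrence.

   For a mixed state M is affine along ensembles and the trace norm is convex. *)

theory Submission
  imports Defs "HOL-Analysis.L2_Norm"
begin

subsection \<open>Spectral and singular value decompositions\<close>

text \<open>Two obstacles shape the development. \<open>psd_sqrt\<close> is a definite description,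
  so evaluating \<open>trace_norm\<close> needs uniqueness of the positive semidefinite root besides
  an explicit root, which a singular value decomposition supplies. \<open>concurrence\<close> is an
  infimum, so some ensemble has to be exhibited. Both rest on one fact: a nonzero Hermitian matrix
  has a nonzero eigenvalue. The decompositions keep only nonzero eigenvalues, which spares
  completing orthonormal systems to bases. Vectors and matrices are mostly functions of indices with
  the dimension as a separate argument, so sums can be manipulated without carrier conditions. The
  factor sqrt(d(d-1)/2) arises because the reduced state has the nonzero eigenvalues s_t^2, with sum
  1. Hence C^2 / 2 = 1 - sum_t s_t^4 is the sum of (s_t s_u)^2 over t ~= u, while (sum_t s_t)^2 - 1
  is the sum of s_t s_u over the same pairs.\<close>

lemma dim_mat_adjoint [simp]:
  "dim_row (mat_adjoint A) = dim_col A" "dim_col (mat_adjoint A) = dim_row A"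
  by (simp_all add: mat_adjoint_def)

lemma index_mat_adjoint [simp]:
  fixes A :: "complex mat"
  assumes "i < dim_col A" "j < dim_row A"
  shows "mat_adjoint A $$ (i, j) = cnj (A $$ (j, i))"
  using assms by (simp add: mat_adjoint_def mat_of_rows_index)

lemma mat_trace_comm:
  assumes "A \<in> carrier_mat n m" "B \<in> carrier_mat m n"
  shows "mat_trace (A * B) = mat_trace (B * A)"
proof -
  have "mat_trace (A * B) = (\<Sum>i<n. \<Sum>j<m. A $$ (i, j) * B $$ (j, i))"
    using assms by (simp add: mat_trace_def scalar_prod_def atLeast0LessThan)
  also have "\<dots> = (\<Sum>j<m. \<Sum>i<n. B $$ (j, i) * A $$ (i, j))"
    by (subst sum.swap) (simp add: mult.commute)
  also have "\<dots> = mat_trace (B * A)"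
    using assms by (simp add: mat_trace_def scalar_prod_def atLeast0LessThan)
  finally show ?thesis .
qed

section \<open>Inner products and orthonormal systems\<close>

definition ip :: "nat \<Rightarrow> (nat \<Rightarrow> complex) \<Rightarrow> (nat \<Rightarrow> complex) \<Rightarrow> complex" where
  "ip n u v = (\<Sum>a<n. u a * cnj (v a))"

text \<open>Phrased with \<open>L2_set\<close> so that the Cauchy-Schwarz inequality
  \<open>L2_set_mult_ineq\<close> applies directly.\<close>

definition nrm :: "nat \<Rightarrow> (nat \<Rightarrow> complex) \<Rightarrow> real" where
  "nrm n u = L2_set (\<lambda>a. cmod (u a)) {..<n}"

definition orthonormal :: "nat \<Rightarrow> nat \<Rightarrow> (nat \<Rightarrow> nat \<Rightarrow> complex) \<Rightarrow> bool" where
  "orthonormal n k f \<longleftrightarrow> (\<forall>i<k. \<forall>j<k. ip n (f i) (f j) = (if i = j then 1 else 0))"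

definition hermitian :: "nat \<Rightarrow> (nat \<Rightarrow> nat \<Rightarrow> complex) \<Rightarrow> bool" where
  "hermitian n H \<longleftrightarrow> (\<forall>a<n. \<forall>b<n. cnj (H a b) = H b a)"

lemma orthonormalD:
  "orthonormal n k f \<Longrightarrow> i < k \<Longrightarrow> j < k \<Longrightarrow> ip n (f i) (f j) = (if i = j then 1 else 0)"
  by (simp add: orthonormal_def)

lemma hermitianD: "hermitian n H \<Longrightarrow> a < n \<Longrightarrow> b < n \<Longrightarrow> cnj (H a b) = H b a"
  by (simp add: hermitian_def)

lemma ip_cong:
  "(\<And>a. a < n \<Longrightarrow> u a = u' a) \<Longrightarrow> (\<And>a. a < n \<Longrightarrow> v a = v' a) \<Longrightarrow> ip n u v = ip n u' v'"
  by (simp add: ip_def)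

lemma cnj_ip: "cnj (ip n u v) = ip n v u"
  by (simp add: ip_def mult.commute)

lemma Re_ip_commute: "Re (ip n u v) = Re (ip n v u)"
  by (subst cnj_ip [symmetric]) simp

lemma nrm_nonneg [simp]: "0 \<le> nrm n u"
  by (simp add: nrm_def L2_set_nonneg)

lemma nrm_sq: "(nrm n u)\<^sup>2 = (\<Sum>a<n. (cmod (u a))\<^sup>2)"
  by (simp add: nrm_def L2_set_def sum_nonneg)

lemma ip_self: "ip n u u = of_real ((nrm n u)\<^sup>2)"
  unfolding ip_def nrm_sq of_real_sum complex_norm_square ..

lemma nrm_zeroD: "ip n u u = 0 \<Longrightarrow> a < n \<Longrightarrow> u a = 0"
  by (simp add: ip_self) (simp add: nrm_def L2_set_eq_0_iff)

lemma nrm_scale: "nrm n (\<lambda>a. of_real c * u a) = \<bar>c\<bar> * nrm n u"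
  by (simp add: nrm_def norm_mult L2_set_right_distrib)

lemma ip_diff_left: "ip n (\<lambda>a. u a - v a) w = ip n u w - ip n v w"
  by (simp add: ip_def left_diff_distrib sum_subtractf)

lemma ip_diff_right: "ip n w (\<lambda>a. u a - v a) = ip n w u - ip n w v"
  by (simp add: ip_def right_diff_distrib sum_subtractf)

lemma ip_scale_left: "ip n (\<lambda>a. c * u a) v = c * ip n u v"
  by (simp add: ip_def sum_distrib_left mult.assoc)

lemma ip_scale_right: "ip n u (\<lambda>a. c * v a) = cnj c * ip n u v"
  by (simp add: ip_def sum_distrib_left algebra_simps)

lemma ip_sum_left: "ip n (\<lambda>a. \<Sum>i\<in>I. c i * f i a) v = (\<Sum>i\<in>I. c i * ip n (f i) v)"
  by (simp add: ip_def sum_distrib_left sum_distrib_right mult.assoc) (rule sum.swap)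

lemma ip_sum_right: "ip n v (\<lambda>a. \<Sum>i\<in>I. c i * f i a) = (\<Sum>i\<in>I. cnj (c i) * ip n v (f i))"
proof -
  have "ip n v (\<lambda>a. \<Sum>i\<in>I. c i * f i a) = cnj (\<Sum>i\<in>I. c i * ip n (f i) v)"
    by (simp only: ip_sum_left [symmetric] cnj_ip)
  then show ?thesis by (simp add: cnj_ip)
qed

lemma orthonormal_sum:
  assumes "orthonormal n k f" "j < k"
  shows "ip n (\<lambda>a. \<Sum>i<k. c i * f i a) (f j) = c j"
proof -
  have "ip n (\<lambda>a. \<Sum>i<k. c i * f i a) (f j) = (\<Sum>i<k. c i * ip n (f i) (f j))"
    by (rule ip_sum_left)
  also have "\<dots> = (\<Sum>i<k. if i = j then c i else 0)"
    using assms by (intro sum.cong) (auto simp: orthonormalD)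
  finally show ?thesis using assms by simp
qed

lemma orthonormal_sum_ip:
  assumes "orthonormal n k f"
  shows "ip n (\<lambda>a. \<Sum>i<k. c i * f i a) (\<lambda>a. \<Sum>i<k. d i * f i a) = (\<Sum>i<k. c i * cnj (d i))"
  using assms by (simp add: ip_sum_right orthonormal_sum mult.commute)

lemma orthonormal_cnj: "orthonormal n k f \<Longrightarrow> orthonormal n k (\<lambda>i a. cnj (f i a))"
proof -
  have "ip n (\<lambda>a. cnj (f i a)) (\<lambda>a. cnj (f j a)) = ip n (f j) (f i)" for i j
    by (simp add: ip_def mult.commute)
  then show "orthonormal n k f \<Longrightarrow> orthonormal n k (\<lambda>i a. cnj (f i a))"
    by (simp add: orthonormal_def)
qed

text \<open>Subtracting from \<open>v\<close> its projection onto the span of the \<open>f i\<close>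
  leaves a vector whose squared norm is the difference of the two sides.\<close>

lemma bessel:
  assumes "orthonormal n k f"
  shows "(\<Sum>i<k. (cmod (ip n v (f i)))\<^sup>2) \<le> (nrm n v)\<^sup>2"
proof -
  let ?p = "\<lambda>a. \<Sum>i<k. ip n v (f i) * f i a"
  let ?w = "\<lambda>a. v a - ?p a"
  let ?S = "\<Sum>i<k. (cmod (ip n v (f i)))\<^sup>2"
  have S: "of_real ?S = (\<Sum>i<k. ip n v (f i) * cnj (ip n v (f i)))"
    unfolding of_real_sum complex_norm_square ..
  have pv: "ip n ?p v = of_real ?S"
    unfolding S ip_sum_left by (simp add: cnj_ip)
  then have vp: "ip n v ?p = of_real ?S"
    using cnj_ip [of n ?p v] by simp
  have pp: "ip n ?p ?p = of_real ?S"
    unfolding S using assms by (rule orthonormal_sum_ip)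
  have "ip n ?w ?w = of_real ((nrm n v)\<^sup>2 - ?S)"
    unfolding ip_diff_left ip_diff_right pv vp pp ip_self [of n v] by simp
  then have "(nrm n ?w)\<^sup>2 = (nrm n v)\<^sup>2 - ?S"
    unfolding ip_self of_real_eq_iff .
  then show ?thesis
    using zero_le_power2 [of "nrm n ?w"] by linarith
qed

text \<open>Double counting of the squared moduli of all coordinates of the \<open>f i\<close>: each
  vector contributes exactly 1, and by Bessel for the standard basis vectors each coordinate
  contributes at most 1.\<close>

lemma orthonormal_le:
  assumes "orthonormal n k f"
  shows "k \<le> n"
proof -
  let ?e = "\<lambda>a b. if b = a then 1 else 0 :: complex"
  have e: "ip n (?e a) v = cnj (v a)" if "a < n" for a v
  proof -
    have "ip n (?e a) v = (\<Sum>b<n. if b = a then cnj (v b) else 0)"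
      unfolding ip_def by (intro sum.cong) auto
    then show ?thesis using that by simp
  qed
  have ne: "(nrm n (?e a))\<^sup>2 = 1" if "a < n" for a
  proof -
    have "ip n (?e a) (?e a) = 1" by (subst e [OF that]) simp
    then show ?thesis by (metis ip_self of_real_eq_1_iff)
  qed
  have nf: "(nrm n (f i))\<^sup>2 = 1" if "i < k" for i
    using orthonormalD [OF assms that that] unfolding ip_self by (metis of_real_eq_1_iff)
  have "real k = (\<Sum>i<k. (nrm n (f i))\<^sup>2)"
    by (simp add: nf)
  also have "\<dots> = (\<Sum>a<n. \<Sum>i<k. (cmod (f i a))\<^sup>2)"
    unfolding nrm_sq by (rule sum.swap)
  also have "\<dots> = (\<Sum>a<n. \<Sum>i<k. (cmod (ip n (?e a) (f i)))\<^sup>2)"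
    by (simp add: e)
  also have "\<dots> \<le> (\<Sum>a<n. (nrm n (?e a))\<^sup>2)"
    by (intro sum_mono bessel assms)
  also have "\<dots> = real n" by (simp add: ne)
  finally show ?thesis by simp
qed

section \<open>Eigenvalues of Hermitian matrices\<close>

lemma hermitian_ip:
  assumes "hermitian n H"
  shows "ip n (\<lambda>a. \<Sum>b<n. H a b * u b) v = ip n u (\<lambda>a. \<Sum>b<n. H a b * v b)"
proof -
  have "ip n (\<lambda>a. \<Sum>b<n. H a b * u b) v = (\<Sum>a<n. \<Sum>b<n. H a b * u b * cnj (v a))"
    by (simp add: ip_def sum_distrib_right)
  also have "\<dots> = (\<Sum>b<n. \<Sum>a<n. H a b * u b * cnj (v a))"
    by (rule sum.swap)
  also have "\<dots> = (\<Sum>b<n. \<Sum>a<n. u b * cnj (H b a * v a))"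
    using assms by (intro sum.cong refl) (simp add: hermitianD)
  finally show ?thesis by (simp add: ip_def sum_distrib_left)
qed

text \<open>If all eigenvalues of \<open>H\<close> vanish, its Schur form is strictly upper triangular, so
  \<open>H\<^sup>2\<close> has trace 0; but for a Hermitian matrix this trace is the sum of the squared moduli of
  the entries.\<close>
lemma hermitian_nonzero_eigenvalue:
  assumes herm: "hermitian n H" and "a < n" "b < n" "H a b \<noteq> 0"
  shows "\<exists>v \<mu>. (\<mu> :: real) \<noteq> 0 \<and> ip n v v = 1 \<and> (\<forall>i<n. (\<Sum>j<n. H i j * v j) = of_real \<mu> * v i)"
proof -
  define M where "M = mat n n (\<lambda>(i, j). H i j)"
  have M: "M \<in> carrier_mat n n" by (simp add: M_def)
  obtain es where es: "char_poly M = (\<Prod>e\<leftarrow>es. [:- e, 1:])"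
    using char_poly_factorized [OF M] by auto
  obtain B P Q where "schur_decomposition M es = (B, P, Q)"
    by (metis prod_cases3)
  from schur_decomposition [OF M es this]
  have sim: "similar_mat_wit M B P Q" and ut: "upper_triangular B" and diag: "diag_mat B = es"
    by auto
  note w = similar_mat_witD2 [OF M sim]
  have trsq: "mat_trace (M * M) = of_real (\<Sum>i<n. \<Sum>j<n. (cmod (H i j))\<^sup>2)"
  proof -
    have "mat_trace (M * M) = (\<Sum>i<n. \<Sum>j<n. H i j * H j i)"
      by (simp add: mat_trace_def M_def scalar_prod_def atLeast0LessThan)
    also have "\<dots> = (\<Sum>i<n. \<Sum>j<n. H i j * cnj (H i j))"
      using herm by (intro sum.cong refl) (simp add: hermitianD)
    finally show ?thesis unfolding of_real_sum complex_norm_square .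
  qed
  have pos: "(\<Sum>i<n. \<Sum>j<n. (cmod (H i j))\<^sup>2) > 0"
    using assms by (intro sum_pos2 [of _ a] sum_pos2 [of _ b] sum_nonneg) auto
  have "\<exists>e\<in>set es. e \<noteq> 0"
  proof (rule ccontr)
    assume "\<not> ?thesis"
    then have d0: "B $$ (i, i) = 0" if "i < n" for i
      using that w(5) unfolding diag [symmetric] diag_mat_def by auto
    \<comment> \<open>One of the two entries lies on or below the diagonal, where \<open>B\<close>
      vanishes.\<close>
    have "B $$ (i, j) * B $$ (j, i) = 0" if "i < n" "j < n" for i j
      using ut d0 that w(5) by (cases i j rule: linorder_cases) (auto simp: upper_triangular_def)
    then have B0: "mat_trace (B * B) = 0"
      using w(5) by (auto simp: mat_trace_def scalar_prod_def atLeast0LessThan intro!: sum.neutral)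
    have "M * M = P * B * (Q * P) * (B * Q)"
      unfolding w(3) using w(4-7) by (simp add: assoc_mult_mat [of _ n n _ n _ n])
    also have "\<dots> = P * (B * B) * Q"
      unfolding w(2) using w(4-7) by (simp add: assoc_mult_mat [of _ n n _ n _ n])
    finally have "mat_trace (M * M) = mat_trace (P * (B * B) * Q)" by simp
    also have "\<dots> = mat_trace (Q * (P * (B * B)))"
      using w by (intro mat_trace_comm [of _ n n]) auto
    also have "Q * (P * (B * B)) = Q * P * (B * B)"
      using w(5-7) by (intro assoc_mult_mat [symmetric, of _ n n _ n _ n]) auto
    also have "\<dots> = B * B" using w by simp
    finally have "mat_trace (M * M) = 0" using B0 by simp
    then show False using pos unfolding trsq of_real_eq_0_iff by simp
  qed
  then obtain e where e: "e \<in> set es" "e \<noteq> 0" by auto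
  have "poly (char_poly M) e = 0"
    unfolding es poly_prod_list prod_list_zero_iff using e by force
  then have "eigenvalue M e" using eigenvalue_root_char_poly [OF M] by simp
  then obtain x where x: "x \<in> carrier_vec n" "x \<noteq> 0\<^sub>v n" "M *\<^sub>v x = e \<cdot>\<^sub>v x"
    using M by (auto simp: eigenvalue_def eigenvector_def)
  define u where "u = (\<lambda>i. x $ i)"
  have Hu: "(\<Sum>j<n. H i j * u j) = e * u i" if "i < n" for i
    using arg_cong [OF x(3), of "\<lambda>v. v $ i"] x(1) that
    by (simp add: M_def u_def scalar_prod_def atLeast0LessThan)
  have nz: "ip n u u \<noteq> 0"
  proof
    assume "ip n u u = 0"
    then have "x = 0\<^sub>v n" using x(1) nrm_zeroD [of n u] by (intro eq_vecI) (auto simp: u_def)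
    with x(2) show False ..
  qed
  \<comment> \<open>Self-adjointness equates \<open>e\<close> and \<open>cnj e\<close> after
    cancelling the nonzero \<open>ip n u u\<close>, so the eigenvalue is real.\<close>
  have "e * ip n u u = ip n (\<lambda>i. \<Sum>j<n. H i j * u j) u"
    unfolding ip_scale_left [symmetric] by (rule ip_cong) (auto simp: Hu)
  also have "\<dots> = ip n u (\<lambda>i. \<Sum>j<n. H i j * u j)" by (rule hermitian_ip [OF herm])
  also have "\<dots> = cnj e * ip n u u"
    unfolding ip_scale_right [symmetric] by (rule ip_cong) (auto simp: Hu)
  finally have "cnj e = e" using nz by simp
  then have er: "e = of_real (Re e)" by (metis Reals_cnj_iff of_real_Re)
  define c where "c = complex_of_real (1 / nrm n u)"
  have n0: "nrm n u \<noteq> 0" using nz by (simp add: ip_self)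
  have "ip n (\<lambda>i. c * u i) (\<lambda>i. c * u i) = 1"
    unfolding ip_scale_left ip_scale_right ip_self c_def using n0 by (simp add: power2_eq_square)
  moreover have "(\<Sum>j<n. H i j * (c * u j)) = of_real (Re e) * (c * u i)" if "i < n" for i
  proof -
    have "(\<Sum>j<n. H i j * (c * u j)) = c * (\<Sum>j<n. H i j * u j)"
      by (simp add: sum_distrib_left algebra_simps)
    then show ?thesis using Hu [OF that] er by (simp add: algebra_simps)
  qed
  moreover have "Re e \<noteq> 0" using er e by auto
  ultimately show ?thesis by blast
qed

text \<open>Deflation: subtract from \<open>H\<close> the part carried by a largest orthonormal
  family of eigenvectors with nonzero eigenvalues. A nonzero remainder \<open>T\<close> would have
  an eigenvector of nonzero eigenvalue, and this vector would enlarge the family.\<close>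

lemma spectral_decomposition:
  assumes herm: "hermitian n H"
  shows "\<exists>k \<mu> f. orthonormal n k f \<and> (\<forall>i<k. (\<mu> i :: real) \<noteq> 0) \<and>
    (\<forall>a<n. \<forall>b<n. H a b = (\<Sum>i<k. of_real (\<mu> i) * f i a * cnj (f i b)))"
proof -
  define E where "E = (\<lambda>k \<mu> f. orthonormal n k f \<and> (\<forall>i<k. (\<mu> i :: real) \<noteq> 0) \<and>
    (\<forall>i<k. \<forall>a<n. (\<Sum>b<n. H a b * f i b) = of_real (\<mu> i) * f i a))"
  \<comment> \<open>The greatest \<open>k\<close> exists because the empty family qualifies and
    orthonormality forces \<open>k\<close> to be at most \<open>n\<close>.\<close>
  define k where "k = (GREATEST k. \<exists>\<mu> f. E k \<mu> f)"
  have ex0: "\<exists>\<mu> f. E 0 \<mu> f" by (simp add: E_def orthonormal_def)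
  have bd: "\<forall>k. (\<exists>\<mu> f. E k \<mu> f) \<longrightarrow> k \<le> n" by (auto simp: E_def dest: orthonormal_le)
  obtain \<mu> f where E: "E k \<mu> f"
    using GreatestI_nat [of "\<lambda>k. \<exists>\<mu> f. E k \<mu> f", OF ex0] bd unfolding k_def by blast
  then have on: "orthonormal n k f" and nz: "\<forall>i<k. \<mu> i \<noteq> 0"
    and ev: "\<And>i a. i < k \<Longrightarrow> a < n \<Longrightarrow> (\<Sum>b<n. H a b * f i b) = of_real (\<mu> i) * f i a"
    by (auto simp: E_def)
  define T where "T = (\<lambda>a b. H a b - (\<Sum>i<k. of_real (\<mu> i) * f i a * cnj (f i b)))"
  have hT: "hermitian n T"
    using herm unfolding hermitian_def T_def by (simp add: algebra_simps)
  have Tv: "(\<Sum>b<n. T a b * v b) = (\<Sum>b<n. H a b * v b) - (\<Sum>i<k. of_real (\<mu> i) * ip n v (f i) * f i a)"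
    for a v
  proof -
    have "(\<Sum>b<n. \<Sum>i<k. of_real (\<mu> i) * f i a * cnj (f i b) * v b) =
      (\<Sum>i<k. \<Sum>b<n. of_real (\<mu> i) * f i a * cnj (f i b) * v b)" by (rule sum.swap)
    also have "\<dots> = (\<Sum>i<k. of_real (\<mu> i) * ip n v (f i) * f i a)"
      unfolding ip_def sum_distrib_left sum_distrib_right by (simp add: algebra_simps)
    finally show ?thesis
      unfolding T_def by (simp add: left_diff_distrib sum_subtractf sum_distrib_right)
  qed
  have "T a b = 0" if ab: "a < n" "b < n" for a b
  proof (rule ccontr)
    assume "T a b \<noteq> 0"
    from hermitian_nonzero_eigenvalue [OF hT ab this]
    obtain v \<nu> where \<nu>: "(\<nu> :: real) \<noteq> 0" and v: "ip n v v = 1"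
      and Tv': "\<And>i. i < n \<Longrightarrow> (\<Sum>j<n. T i j * v j) = of_real \<nu> * v i" by blast
    \<comment> \<open>\<open>T\<close> annihilates every \<open>f i\<close>, so moving
      \<open>T\<close> across the inner product gives \<nu> * \<open>ip n v (f i)\<close> =
      0.\<close>
    have orth: "ip n v (f i) = 0" if "i < k" for i
    proof -
      have Tf: "(\<Sum>b<n. T a b * f i b) = 0" if "a < n" for a
      proof -
        have "(\<Sum>j<k. of_real (\<mu> j) * ip n (f i) (f j) * f j a) =
          (\<Sum>j<k. if i = j then of_real (\<mu> j) * f j a else 0)"
          by (intro sum.cong refl) (simp add: orthonormalD [OF on \<open>i < k\<close>])
        then show ?thesis unfolding Tv using ev [OF \<open>i < k\<close> that] \<open>i < k\<close> by simp
      qed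
      have "of_real \<nu> * ip n v (f i) = ip n (\<lambda>a. \<Sum>b<n. T a b * v b) (f i)"
        unfolding ip_scale_left [symmetric] by (rule ip_cong) (auto simp: Tv')
      also have "\<dots> = ip n v (\<lambda>a. \<Sum>b<n. T a b * f i b)" by (rule hermitian_ip [OF hT])
      also have "\<dots> = 0" by (simp add: ip_def Tf)
      finally show ?thesis using \<nu> by simp
    qed
    have "ip n (f i) v = 0" if "i < k" for i
      using orth [OF that] by (metis cnj_ip complex_cnj_zero)
    then have "orthonormal n (Suc k) (f(k := v))"
      using on orth v by (auto simp: orthonormal_def less_Suc_eq)
    \<comment> \<open>On vectors orthogonal to all \<open>f i\<close> the matrices \<open>T\<close>
      and \<open>H\<close> agree.\<close>
    moreover have "(\<Sum>b<n. H a b * v b) = of_real \<nu> * v a" if "a < n" for a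
      using Tv' [OF that] unfolding Tv by (simp add: orth)
    ultimately have "E (Suc k) (\<mu>(k := \<nu>)) (f(k := v))"
      unfolding E_def using nz \<nu> ev by (auto simp: less_Suc_eq)
    then have "Suc k \<le> k"
      using Greatest_le_nat [of "\<lambda>k. \<exists>\<mu> f. E k \<mu> f" "Suc k" n] bd unfolding k_def by blast
    then show False by simp
  qed
  then have "H a b = (\<Sum>i<k. of_real (\<mu> i) * f i a * cnj (f i b))" if "a < n" "b < n" for a b
    using that by (simp add: T_def)
  with on nz show ?thesis by blast
qed

section \<open>Singular value decomposition\<close>

lemma nrm_orthonormal: "orthonormal n k f \<Longrightarrow> i < k \<Longrightarrow> nrm n (f i) = 1"
proof -
  assume "orthonormal n k f" "i < k"
  then have "of_real ((nrm n (f i))\<^sup>2) = (1 :: complex)"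
    unfolding ip_self [symmetric] by (simp add: orthonormalD)
  then have "(nrm n (f i))\<^sup>2 = 1" by (simp only: of_real_eq_1_iff)
  then show ?thesis using nrm_nonneg [of n "f i"] by (simp add: power2_eq_1_iff)
qed

text \<open>The compact form: zero singular values are left out, so \<open>k\<close> is the rank on
  the given index range.\<close>

definition is_svd ::
    "nat \<Rightarrow> nat \<Rightarrow> (nat \<Rightarrow> nat \<Rightarrow> complex) \<Rightarrow> nat \<Rightarrow> (nat \<Rightarrow> real) \<Rightarrow> (nat \<Rightarrow> nat \<Rightarrow> complex) \<Rightarrow>
      (nat \<Rightarrow> nat \<Rightarrow> complex) \<Rightarrow> bool" where
  "is_svd m n X k s e f \<longleftrightarrow> orthonormal m k e \<and> orthonormal n k f \<and> (\<forall>i<k. s i > 0) \<and>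
    (\<forall>a<m. \<forall>b<n. X a b = (\<Sum>i<k. of_real (s i) * e i a * cnj (f i b)))"

lemma is_svdD:
  assumes "is_svd m n X k s e f"
  shows "orthonormal m k e" "orthonormal n k f" "\<And>i. i < k \<Longrightarrow> s i > 0"
    "\<And>a b. a < m \<Longrightarrow> b < n \<Longrightarrow> X a b = (\<Sum>i<k. of_real (s i) * e i a * cnj (f i b))"
  using assms by (auto simp: is_svd_def)

text \<open>The right singular vectors are eigenvectors of the Gram matrix \<open>H\<close> of the
  columns of \<open>X\<close>, and the left ones are their normalised images under \<open>X\<close>.
  The omitted kernel does no harm: \<open>X\<close> vanishes on every vector orthogonal to the
  \<open>f i\<close>, because the squared norm of its image is the quadratic form of
  \<open>H\<close>.\<close>

lemma svd_exists: "\<exists>k s e f. is_svd m n X k s e f"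
proof -
  define H where "H = (\<lambda>a b. \<Sum>c<m. cnj (X c a) * X c b)"
  have "hermitian n H" by (simp add: hermitian_def H_def mult.commute)
  from spectral_decomposition [OF this] obtain k \<mu> f where on: "orthonormal n k f"
    and nz: "\<And>i. i < k \<Longrightarrow> (\<mu> i :: real) \<noteq> 0"
    and H: "\<And>a b. a < n \<Longrightarrow> b < n \<Longrightarrow> H a b = (\<Sum>i<k. of_real (\<mu> i) * f i a * cnj (f i b))"
    by blast
  define F where "F = (\<lambda>v a. \<Sum>b<n. X a b * v b)"
  have Hv: "(\<Sum>b<n. H a b * v b) = (\<Sum>i<k. of_real (\<mu> i) * ip n v (f i) * f i a)"
    if "a < n" for a v
  proof -
    have "(\<Sum>b<n. H a b * v b) = (\<Sum>b<n. \<Sum>i<k. of_real (\<mu> i) * f i a * cnj (f i b) * v b)"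
      using that by (simp add: H sum_distrib_right)
    also have "\<dots> = (\<Sum>i<k. \<Sum>b<n. of_real (\<mu> i) * f i a * cnj (f i b) * v b)" by (rule sum.swap)
    also have "\<dots> = (\<Sum>i<k. of_real (\<mu> i) * ip n v (f i) * f i a)"
      unfolding ip_def sum_distrib_left sum_distrib_right by (simp add: algebra_simps)
    finally show ?thesis .
  qed
  have FF: "ip m (F u) (F v) = (\<Sum>i<k. of_real (\<mu> i) * ip n u (f i) * ip n (f i) v)" for u v
  proof -
    have "ip m (F u) (F v) = (\<Sum>c<m. \<Sum>a<n. \<Sum>b<n. cnj (X c a) * X c b * u b * cnj (v a))"
      unfolding ip_def F_def
      by (intro sum.cong refl)
        (simp add: sum_distrib_left sum_distrib_right algebra_simps)
    also have "\<dots> = (\<Sum>a<n. \<Sum>c<m. \<Sum>b<n. cnj (X c a) * X c b * u b * cnj (v a))"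
      by (rule sum.swap)
    also have "\<dots> = (\<Sum>a<n. \<Sum>b<n. \<Sum>c<m. cnj (X c a) * X c b * u b * cnj (v a))"
      by (intro sum.cong refl sum.swap)
    also have "\<dots> = ip n (\<lambda>a. \<Sum>b<n. H a b * u b) v"
      unfolding ip_def H_def by (simp add: sum_distrib_right)
    also have "\<dots> = ip n (\<lambda>a. \<Sum>i<k. of_real (\<mu> i) * ip n u (f i) * f i a) v"
      by (rule ip_cong) (auto simp: Hv)
    finally show ?thesis unfolding ip_sum_left .
  qed
  have Ff: "ip m (F (f i)) (F (f j)) = (if i = j then of_real (\<mu> i) else 0)" if "i < k" "j < k" for i j
  proof -
    have "ip m (F (f i)) (F (f j)) = (\<Sum>l<k. if l = i then of_real (\<mu> i) * ip n (f i) (f j) else 0)"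
      unfolding FF using on \<open>i < k\<close> by (intro sum.cong refl) (auto simp: orthonormalD)
    then show ?thesis using that on by (simp add: orthonormalD)
  qed
  have pos: "\<mu> i > 0" if "i < k" for i
  proof -
    have "complex_of_real (\<mu> i) = of_real ((nrm m (F (f i)))\<^sup>2)"
      unfolding ip_self [symmetric] using Ff [OF that that] by simp
    then have "\<mu> i = (nrm m (F (f i)))\<^sup>2" by (simp only: of_real_eq_iff)
    then show ?thesis using nz [OF that] zero_le_power2 [of "nrm m (F (f i))"] by linarith
  qed
  define e where "e = (\<lambda>i a. of_real (1 / sqrt (\<mu> i)) * F (f i) a)"
  have "ip m (e i) (e j) = (if i = j then 1 else 0)" if "i < k" "j < k" for i j
  proof -
    have "complex_of_real (sqrt (\<mu> i)) * of_real (sqrt (\<mu> i)) = of_real (\<mu> i)"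
      using pos [OF \<open>i < k\<close>] by (simp flip: of_real_mult)
    then show ?thesis
      unfolding e_def ip_scale_left ip_scale_right Ff [OF that] using pos [OF \<open>i < k\<close>]
      by (auto simp: field_simps)
  qed
  then have one: "orthonormal m k e" by (simp add: orthonormal_def)
  have "X a b = (\<Sum>i<k. of_real (sqrt (\<mu> i)) * e i a * cnj (f i b))" if ab: "a < m" "b < n" for a b
  proof -
    \<comment> \<open>\<open>d\<close> is the standard basis vector at \<open>b\<close>, which
      \<open>X\<close> sends to its column \<open>b\<close>, and \<open>w\<close> is its component
      orthogonal to the right singular vectors.\<close>
    define d where "d = (\<lambda>c. if c = b then 1 else 0 :: complex)"
    define w where "w = (\<lambda>c. d c - (\<Sum>i<k. cnj (f i b) * f i c))"
    have "ip n d v = cnj (v b)" for v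
    proof -
      have "ip n d v = (\<Sum>c<n. if c = b then cnj (v c) else 0)"
        unfolding ip_def d_def by (intro sum.cong) auto
      then show ?thesis using ab by simp
    qed
    then have "ip n w (f i) = 0" if "i < k" for i
      unfolding w_def ip_diff_left using orthonormal_sum [OF on that] by simp
    then have "F w a = 0"
      using FF [of w w] nrm_zeroD [of m "F w" a] ab by simp
    moreover have "F w a = X a b - (\<Sum>i<k. cnj (f i b) * F (f i) a)"
    proof -
      have "(\<Sum>c<n. X a c * d c) = (\<Sum>c<n. if c = b then X a c else 0)"
        unfolding d_def by (intro sum.cong) auto
      then have "(\<Sum>c<n. X a c * d c) = X a b" using ab by simp
      moreover have "(\<Sum>c<n. X a c * (\<Sum>i<k. cnj (f i b) * f i c)) = (\<Sum>i<k. cnj (f i b) * F (f i) a)"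
        unfolding F_def sum_distrib_left by (subst sum.swap) (simp add: algebra_simps)
      ultimately show ?thesis
        by (simp add: F_def w_def right_diff_distrib sum_subtractf)
    qed
    ultimately have "X a b = (\<Sum>i<k. cnj (f i b) * F (f i) a)" by simp
    also have "\<dots> = (\<Sum>i<k. of_real (sqrt (\<mu> i)) * e i a * cnj (f i b))"
    proof (intro sum.cong refl)
      fix i assume "i \<in> {..<k}"
      then show "cnj (f i b) * F (f i) a = of_real (sqrt (\<mu> i)) * e i a * cnj (f i b)"
        using nz by (simp add: e_def)
    qed
    finally show ?thesis .
  qed
  moreover have "\<forall>i<k. sqrt (\<mu> i) > 0" using pos by simp
  ultimately show ?thesis using on one unfolding is_svd_def
    by (intro exI [of _ k] exI [of _ "\<lambda>i. sqrt (\<mu> i)"] exI [of _ e] exI [of _ f]) blast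
qed

subsection \<open>The trace norm\<close>

text \<open>Passes from matrices to index functions. Arbitrary functions \<open>u\<close> may be
  tested since only their first \<open>n\<close> values enter.\<close>

lemma psd_mat_iff:
  "psd_mat n A \<longleftrightarrow> A \<in> carrier_mat n n \<and> hermitian n (\<lambda>a b. A $$ (a, b)) \<and>
    (\<forall>u. 0 \<le> Re (ip n (\<lambda>a. \<Sum>b<n. A $$ (a, b) * u b) u))"
proof (cases "A \<in> carrier_mat n n")
  case True
  have "mat_adjoint A = A \<longleftrightarrow> hermitian n (\<lambda>a b. A $$ (a, b))"
    using True by (auto simp: hermitian_def mat_eq_iff)
  moreover have q: "(A *\<^sub>v v) \<bullet>c v = ip n (\<lambda>a. \<Sum>b<n. A $$ (a, b) * v $ b) (\<lambda>a. v $ a)"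
    if "v \<in> carrier_vec n" for v
    using True that by (simp add: ip_def scalar_prod_def atLeast0LessThan)
  moreover have "0 \<le> Re (ip n (\<lambda>a. \<Sum>b<n. A $$ (a, b) * u b) u)"
    if *: "\<forall>v\<in>carrier_vec n. 0 \<le> Re ((A *\<^sub>v v) \<bullet>c v)" for u
  proof -
    have "0 \<le> Re ((A *\<^sub>v vec n u) \<bullet>c vec n u)" using * by simp
    also have "(A *\<^sub>v vec n u) \<bullet>c vec n u = ip n (\<lambda>a. \<Sum>b<n. A $$ (a, b) * u b) u"
      unfolding q [OF vec_carrier] by (rule ip_cong) auto
    finally show ?thesis .
  qed
  ultimately show ?thesis using True unfolding psd_mat_def by auto
qed (simp add: psd_mat_def)

text \<open>Suppose B - C has a unit eigenvector v with eigenvalue \<mu> ~= 0. Equal squares give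
  |Bv| = |Cv|, so \<mu> times the sum of the two quadratic forms at v is |Bv|^2 - |Cv|^2 = 0. Both
  forms are nonnegative, hence zero, but their difference is \<mu>.\<close>

lemma psd_mat_sq_inject:
  assumes B: "psd_mat n B" and C: "psd_mat n C" and eq: "B * B = C * C"
  shows "B = C"
proof -
  define b c where "b = (\<lambda>i j. B $$ (i, j))" and "c = (\<lambda>i j. C $$ (i, j))"
  have carr: "B \<in> carrier_mat n n" "C \<in> carrier_mat n n"
    and hb: "hermitian n b" and hc: "hermitian n c"
    and pb: "\<And>u. 0 \<le> Re (ip n (\<lambda>i. \<Sum>j<n. b i j * u j) u)"
    and pc: "\<And>u. 0 \<le> Re (ip n (\<lambda>i. \<Sum>j<n. c i j * u j) u)"
    using B C by (auto simp: psd_mat_iff b_def c_def)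
  define d where "d = (\<lambda>i j. b i j - c i j)"
  have hd: "hermitian n d" using hb hc by (simp add: hermitian_def d_def)
  have "d x y = 0" if xy: "x < n" "y < n" for x y
  proof (rule ccontr)
    assume "d x y \<noteq> 0"
    from hermitian_nonzero_eigenvalue [OF hd xy this]
    obtain v \<mu> where \<mu>: "(\<mu> :: real) \<noteq> 0" and v: "ip n v v = 1"
      and dv: "\<And>i. i < n \<Longrightarrow> (\<Sum>j<n. d i j * v j) = of_real \<mu> * v i" by blast
    define bv cv where "bv = (\<lambda>i. \<Sum>j<n. b i j * v j)" and "cv = (\<lambda>i. \<Sum>j<n. c i j * v j)"
    have dv': "bv i - cv i = of_real \<mu> * v i" if "i < n" for i
      using dv [OF that] by (simp add: bv_def cv_def d_def left_diff_distrib sum_subtractf)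
    have sq: "(\<Sum>j<n. b i j * bv j) = (\<Sum>j<n. c i j * cv j)" if "i < n" for i
    proof -
      have "(\<Sum>j<n. b i j * bv j) = (\<Sum>k<n. (B * B) $$ (i, k) * v k)"
        using that carr unfolding bv_def sum_distrib_left
        by (subst sum.swap) (simp add: b_def scalar_prod_def atLeast0LessThan sum_distrib_right mult.assoc)
      moreover have "(\<Sum>j<n. c i j * cv j) = (\<Sum>k<n. (C * C) $$ (i, k) * v k)"
        using that carr unfolding cv_def sum_distrib_left
        by (subst sum.swap) (simp add: c_def scalar_prod_def atLeast0LessThan sum_distrib_right mult.assoc)
      ultimately show ?thesis using eq by simp
    qed
    have "ip n bv bv = ip n v (\<lambda>i. \<Sum>j<n. b i j * bv j)"
      unfolding bv_def by (rule hermitian_ip [OF hb])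
    also have "\<dots> = ip n v (\<lambda>i. \<Sum>j<n. c i j * cv j)"
      by (rule ip_cong) (auto simp: sq)
    also have "\<dots> = ip n cv cv"
      unfolding cv_def by (rule hermitian_ip [OF hc, symmetric])
    finally have bc: "ip n bv bv = ip n cv cv" .
    have lft: "of_real \<mu> * ip n v w = ip n bv w - ip n cv w" for w
      unfolding ip_scale_left [symmetric] ip_diff_left [symmetric]
      by (rule ip_cong) (auto simp: dv')
    have "\<mu> * (Re (ip n v bv) + Re (ip n v cv)) = 0"
      using arg_cong [OF lft [of bv], of Re] arg_cong [OF lft [of cv], of Re] bc Re_ip_commute [of n bv cv]
      by (simp add: distrib_left)
    moreover have "Re (ip n v bv) \<ge> 0" "Re (ip n v cv) \<ge> 0"
      using pb [of v] pc [of v] hermitian_ip [OF hb, of v v] hermitian_ip [OF hc, of v v]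
      by (simp_all add: bv_def cv_def)
    ultimately have "Re (ip n v bv) = 0" "Re (ip n v cv) = 0" using \<mu> by auto
    then have "Re (ip n bv v) = 0" "Re (ip n cv v) = 0"
      by (simp_all add: Re_ip_commute [of n v])
    then show False using arg_cong [OF lft [of v], of Re] v \<mu> by simp
  qed
  then show ?thesis using carr by (intro eq_matI) (auto simp: d_def b_def c_def)
qed

text \<open>Orthonormality of the left vectors removes the cross terms of the Gram matrix. This
  serves the matrix in \<open>trace_norm_eq\<close>, its square root (with \<open>f\<close> also on
  the left) and the square of a reduced state.\<close>

lemma gram_sum:
  assumes "orthonormal m k e"
  shows "(\<Sum>c<m. cnj (\<Sum>i<k. of_real (s i) * e i c * cnj (f i a)) *
      (\<Sum>i<k. of_real (s i) * e i c * cnj (f i b))) =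
    (\<Sum>i<k. of_real ((s i)\<^sup>2) * f i a * cnj (f i b))"
proof -
  let ?g = "\<lambda>b c. \<Sum>i<k. (of_real (s i) * cnj (f i b)) * e i c"
  have "(\<Sum>i<k. (of_real (s i) * cnj (f i b)) * cnj (of_real (s i) * cnj (f i a))) = ip m (?g b) (?g a)"
    by (rule orthonormal_sum_ip [OF assms, symmetric])
  then show ?thesis by (simp add: ip_def algebra_simps power2_eq_square)
qed

text \<open>The square root is explicit: replacing the left singular vectors by the right ones gives
  a positive semidefinite \<open>B\<close> with the same Gram matrix, and its trace is the sum of
  the \<open>s i\<close>.\<close>

lemma trace_norm_eq:
  assumes A: "A \<in> carrier_mat m n" and svd: "is_svd m n (\<lambda>a b. A $$ (a, b)) k s e f"
  shows "trace_norm A = (\<Sum>i<k. s i)"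
proof -
  note e = is_svdD(1) [OF svd] and f = is_svdD(2) [OF svd] and s = is_svdD(3) [OF svd]
    and eq = is_svdD(4) [OF svd]
  define B where "B = mat n n (\<lambda>(a, b). \<Sum>i<k. of_real (s i) * f i a * cnj (f i b))"
  have Bi: "B $$ (a, b) = (\<Sum>i<k. of_real (s i) * f i a * cnj (f i b))" if "a < n" "b < n" for a b
    using that by (simp add: B_def)
  have hB: "hermitian n (\<lambda>a b. B $$ (a, b))"
    by (simp add: hermitian_def Bi algebra_simps)
  have qB: "ip n (\<lambda>a. \<Sum>b<n. B $$ (a, b) * u b) u = of_real (\<Sum>i<k. s i * (cmod (ip n u (f i)))\<^sup>2)" for u
  proof -
    have "ip n (\<lambda>a. \<Sum>b<n. B $$ (a, b) * u b) u =
      ip n (\<lambda>a. \<Sum>i<k. of_real (s i) * ip n u (f i) * f i a) u"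
    proof (rule ip_cong)
      fix a assume a: "a < n"
      have "(\<Sum>b<n. B $$ (a, b) * u b) = (\<Sum>b<n. \<Sum>i<k. of_real (s i) * f i a * cnj (f i b) * u b)"
        using a by (simp add: Bi sum_distrib_right)
      also have "\<dots> = (\<Sum>i<k. \<Sum>b<n. of_real (s i) * f i a * cnj (f i b) * u b)" by (rule sum.swap)
      also have "\<dots> = (\<Sum>i<k. of_real (s i) * ip n u (f i) * f i a)"
        unfolding ip_def sum_distrib_left sum_distrib_right by (simp add: algebra_simps)
      finally show "(\<Sum>b<n. B $$ (a, b) * u b) = (\<Sum>i<k. of_real (s i) * ip n u (f i) * f i a)" .
    qed simp
    also have "\<dots> = (\<Sum>i<k. of_real (s i) * (ip n u (f i) * cnj (ip n u (f i))))"
      unfolding ip_sum_left by (simp add: cnj_ip mult.assoc)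
    finally show ?thesis unfolding of_real_sum of_real_mult complex_norm_square .
  qed
  have psdB: "psd_mat n B"
    unfolding psd_mat_iff qB using hB s
    by (auto simp: B_def less_imp_le intro!: sum_nonneg mult_nonneg_nonneg)
  have "B * B = mat_adjoint A * A"
  proof (intro eq_matI)
    fix a b assume "a < dim_row (mat_adjoint A * A)" "b < dim_col (mat_adjoint A * A)"
    then have ab: "a < n" "b < n" using A by auto
    \<comment> \<open>Since \<open>B\<close> is Hermitian, its square is its Gram matrix, so
      \<open>gram_sum\<close> applies to both sides.\<close>
    have "(B * B) $$ (a, b) = (\<Sum>c<n. cnj (B $$ (c, a)) * B $$ (c, b))"
      using ab hB by (simp add: B_def scalar_prod_def atLeast0LessThan hermitian_def)
    also have "\<dots> = (\<Sum>i<k. of_real ((s i)\<^sup>2) * f i a * cnj (f i b))"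
      using ab gram_sum [OF f, of s f a b] by (simp add: Bi)
    also have "\<dots> = (\<Sum>c<m. cnj (A $$ (c, a)) * A $$ (c, b))"
      using ab gram_sum [OF e, of s f a b] by (simp add: eq)
    also have "\<dots> = (mat_adjoint A * A) $$ (a, b)"
      using ab A by (simp add: scalar_prod_def atLeast0LessThan)
    finally show "(B * B) $$ (a, b) = (mat_adjoint A * A) $$ (a, b)" .
  qed (use A in \<open>auto simp: B_def\<close>)
  then have "psd_sqrt (mat_adjoint A * A) = B"
    unfolding psd_sqrt_def using psdB A
    by (intro the_equality) (auto intro: psd_mat_sq_inject)
  then have "trace_norm A = Re (\<Sum>a<n. \<Sum>i<k. of_real (s i) * f i a * cnj (f i a))"
    by (simp add: trace_norm_def mat_trace_def B_def)
  also have "(\<Sum>a<n. \<Sum>i<k. of_real (s i) * f i a * cnj (f i a)) = (\<Sum>i<k. of_real (s i) * ip n (f i) (f i))"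
    by (subst sum.swap) (simp add: ip_def sum_distrib_left mult.assoc)
  also have "\<dots> = of_real (\<Sum>i<k. s i)"
    using f by (simp add: orthonormalD)
  finally show ?thesis by simp
qed

text \<open>Each singular value is the inner product of A f_i with e_i, which splits over
  \<open>T\<close> into products of one coefficient of \<open>x t\<close> and one of
  \<open>y t\<close>.\<close>

lemma trace_norm_le:
  assumes A: "A \<in> carrier_mat m n"
    and eq: "\<And>a b. a < m \<Longrightarrow> b < n \<Longrightarrow> A $$ (a, b) = (\<Sum>t\<in>T. x t a * y t b)"
  shows "trace_norm A \<le> (\<Sum>t\<in>T. nrm m (x t) * nrm n (y t))"
proof -
  obtain k s e f where S: "is_svd m n (\<lambda>a b. A $$ (a, b)) k s e f"
    using svd_exists by blast
  note e = is_svdD(1) [OF S] and f = is_svdD(2) [OF S] and s = is_svdD(3) [OF S]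
    and svd = is_svdD(4) [OF S]
  \<comment> \<open>The terms are x y^T without conjugation, so \<open>y t\<close> is paired with
    the conjugated right singular vectors.\<close>
  define g where "g = (\<lambda>i b. cnj (f i b))"
  have g: "orthonormal n k g" unfolding g_def by (rule orthonormal_cnj [OF f])
  have si: "of_real (s i) = (\<Sum>t\<in>T. ip m (x t) (e i) * ip n (y t) (g i))" if i: "i < k" for i
  proof -
    have "of_real (s i) = ip m (\<lambda>a. of_real (s i) * e i a) (e i)"
      unfolding ip_scale_left using e i by (simp add: orthonormalD)
    also have "\<dots> = ip m (\<lambda>a. \<Sum>t\<in>T. ip n (y t) (g i) * x t a) (e i)"
    proof (rule ip_cong)
      fix a assume a: "a < m"
      have "of_real (s i) * e i a = (\<Sum>j<k. if i = j then of_real (s j) * e j a else 0)"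
        using i by simp
      also have "\<dots> = (\<Sum>j<k. of_real (s j) * e j a * ip n (f i) (f j))"
        using f i by (intro sum.cong refl) (auto simp: orthonormalD)
      also have "\<dots> = (\<Sum>b<n. A $$ (a, b) * f i b)"
        using a unfolding ip_def sum_distrib_left
        by (subst sum.swap) (simp add: svd sum_distrib_left algebra_simps)
      also have "\<dots> = (\<Sum>t\<in>T. ip n (y t) (g i) * x t a)"
        using a unfolding ip_def g_def sum_distrib_left sum_distrib_right
        by (subst sum.swap) (simp add: eq sum_distrib_left algebra_simps)
      finally show "of_real (s i) * e i a = (\<Sum>t\<in>T. ip n (y t) (g i) * x t a)" .
    qed simp
    finally show ?thesis unfolding ip_sum_left by (simp add: mult.commute)
  qed
  have bes: "L2_set (\<lambda>i. cmod (ip p v (h i))) {..<k} \<le> nrm p v" if "orthonormal p k h" for p v h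
    unfolding L2_set_def by (rule real_le_lsqrt) (simp_all add: sum_nonneg bessel [OF that])
  have "trace_norm A = (\<Sum>i<k. s i)"
    by (rule trace_norm_eq [OF A S])
  also have "\<dots> \<le> (\<Sum>i<k. \<Sum>t\<in>T. cmod (ip m (x t) (e i)) * cmod (ip n (y t) (g i)))"
  proof (rule sum_mono)
    fix i assume "i \<in> {..<k}"
    then have "s i = cmod (\<Sum>t\<in>T. ip m (x t) (e i) * ip n (y t) (g i))"
      using s [of i] by (simp flip: si)
    also have "\<dots> \<le> (\<Sum>t\<in>T. cmod (ip m (x t) (e i)) * cmod (ip n (y t) (g i)))"
      by (rule sum_norm_le) (simp add: norm_mult)
    finally show "s i \<le> \<dots>" .
  qed
  also have "\<dots> = (\<Sum>t\<in>T. \<Sum>i<k. cmod (ip m (x t) (e i)) * cmod (ip n (y t) (g i)))"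
    by (rule sum.swap)
  also have "\<dots> \<le> (\<Sum>t\<in>T. nrm m (x t) * nrm n (y t))"
  proof (rule sum_mono)
    fix t
    have "(\<Sum>i<k. cmod (ip m (x t) (e i)) * cmod (ip n (y t) (g i))) \<le>
        L2_set (\<lambda>i. cmod (ip m (x t) (e i))) {..<k} * L2_set (\<lambda>i. cmod (ip n (y t) (g i))) {..<k}"
      using L2_set_mult_ineq [of "\<lambda>i. cmod (ip m (x t) (e i))" "\<lambda>i. cmod (ip n (y t) (g i))"]
      by simp
    also have "\<dots> \<le> nrm m (x t) * nrm n (y t)"
      by (intro mult_mono bes e g) (auto simp: L2_set_nonneg)
    finally show "(\<Sum>i<k. cmod (ip m (x t) (e i)) * cmod (ip n (y t) (g i))) \<le> \<dots>" .
  qed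
  finally show ?thesis .
qed

text \<open>Weighted by \<open>p i\<close>, the singular value decompositions of all
  \<open>A i\<close> together write \<open>M\<close> as a sum of rank one terms of total size equal
  to the right side.\<close>

lemma trace_norm_convex:
  fixes A :: "nat \<Rightarrow> complex mat"
  assumes A: "\<And>i. i < r \<Longrightarrow> A i \<in> carrier_mat m n" and p: "\<And>i. i < r \<Longrightarrow> 0 \<le> p i"
    and M: "M \<in> carrier_mat m n"
    and eq: "\<And>a b. a < m \<Longrightarrow> b < n \<Longrightarrow> M $$ (a, b) = (\<Sum>i<r. of_real (p i) * A i $$ (a, b))"
  shows "trace_norm M \<le> (\<Sum>i<r. p i * trace_norm (A i))"
proof -
  have "\<forall>i. \<exists>k s e f. is_svd m n (\<lambda>a b. A i $$ (a, b)) k s e f"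
    using svd_exists by blast
  then obtain k s e f where S: "\<And>i. is_svd m n (\<lambda>a b. A i $$ (a, b)) (k i) (s i) (e i) (f i)"
    by metis
  note e = is_svdD(1) [OF S] and f = is_svdD(2) [OF S] and s = is_svdD(3) [OF S]
    and svd = is_svdD(4) [OF S]
  let ?T = "SIGMA i:{..<r}. {..<k i}"
  let ?x = "\<lambda>(i, j) a. of_real (p i * s i j) * e i j a" and ?y = "\<lambda>(i, j) b. cnj (f i j b)"
  have Sig: "sum h ?T = (\<Sum>i<r. \<Sum>j<k i. h (i, j))" for h :: "nat \<times> nat \<Rightarrow> 'a :: comm_monoid_add"
    by (subst sum.Sigma) auto
  have "trace_norm M \<le> (\<Sum>t\<in>?T. nrm m (?x t) * nrm n (?y t))"
  proof (rule trace_norm_le [OF M])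
    fix a b assume "a < m" "b < n"
    then have "M $$ (a, b) = (\<Sum>i<r. \<Sum>j<k i. of_real (p i * s i j) * e i j a * cnj (f i j b))"
      by (simp add: eq svd sum_distrib_left mult.assoc)
    then show "M $$ (a, b) = (\<Sum>t\<in>?T. ?x t a * ?y t b)"
      by (simp add: Sig)
  qed
  also have "\<dots> = (\<Sum>i<r. \<Sum>j<k i. nrm m (?x (i, j)) * nrm n (?y (i, j)))"
    by (rule Sig)
  also have "\<dots> = (\<Sum>i<r. p i * (\<Sum>j<k i. s i j))"
    unfolding sum_distrib_left
  proof (intro sum.cong refl)
    fix i j assume ij: "i \<in> {..<r}" "j \<in> {..<k i}"
    have "nrm m (?x (i, j)) = p i * s i j"
      using ij p [of i] s [of j i] e [of i] by (simp add: nrm_scale nrm_orthonormal del: of_real_mult)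
    moreover have "nrm n (?y (i, j)) = 1"
      using ij nrm_orthonormal [OF orthonormal_cnj [OF f [of i]], of j] by simp
    ultimately show "nrm m (?x (i, j)) * nrm n (?y (i, j)) = p i * s i j" by simp
  qed
  also have "\<dots> = (\<Sum>i<r. p i * trace_norm (A i))"
    using trace_norm_eq [OF A S] by simp
  finally show ?thesis .
qed

subsection \<open>The block matrix of an ensemble and of a pure state\<close>

lemma pair_index_less: "i < m \<Longrightarrow> k < n \<Longrightarrow> i * n + k < m * (n :: nat)"
  by (metis Suc_leI add.commute add_less_mono1 less_le_trans mult_Suc mult_le_mono1)

lemma div_mod_less: "x < m * m \<Longrightarrow> x div m < m \<and> x mod m < (m :: nat)"
  by (cases "m = 0") (auto simp: less_mult_imp_div_less)

lemma sum_lessThan_add: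
  "(\<Sum>x<a + b. h x) = (\<Sum>x<a. h x) + (\<Sum>x<b. h (a + x))"
  for h :: "nat \<Rightarrow> 'a :: comm_monoid_add"
  by (induction b) (auto simp: add.assoc)

lemma sum_pair_index:
  "(\<Sum>c<m * n. h c) = (\<Sum>i<m. \<Sum>k<n. h (i * n + k :: nat))" for h :: "nat \<Rightarrow> 'a :: comm_monoid_add"
proof (induction m)
  case (Suc m)
  have "(\<Sum>c<Suc m * n. h c) = (\<Sum>c<m * n + n. h c)" by (simp add: add.commute)
  also have "\<dots> = (\<Sum>c<m * n. h c) + (\<Sum>k<n. h (m * n + k))" by (rule sum_lessThan_add)
  finally show ?case using Suc by simp
qed simp

lemma ptrace_A_index:
  "k < n \<Longrightarrow> k' < n \<Longrightarrow> ptrace_A m n \<rho> $$ (k, k') = (\<Sum>i<m. \<rho> $$ (i * n + k, i * n + k'))"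
  by (simp add: ptrace_A_def block_def)

lemma ptrace_B_index:
  "i < m \<Longrightarrow> j < m \<Longrightarrow> ptrace_B m n \<rho> $$ (i, j) = (\<Sum>k<n. \<rho> $$ (i * n + k, j * n + k))"
  by (simp add: ptrace_B_def block_def mat_trace_def)

lemma M_mat_carrier: "M_mat m n l \<alpha> \<beta> \<rho> \<in> carrier_mat (l + m * m) (l + n * n)"
  by (simp add: M_mat_def realign_def rep_cols_def ptrace_A_def ptrace_B_def)

lemma M_mat_index:
  assumes "r < l + m * m" "c < l + n * n"
  shows "M_mat m n l \<alpha> \<beta> \<rho> $$ (r, c) =
    (if r < l then
       if c < l then of_real (\<alpha> * \<beta>)
       else of_real \<alpha> * ptrace_A m n \<rho> $$ ((c - l) mod n, (c - l) div n)
     else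
       if c < l then of_real \<beta> * ptrace_B m n \<rho> $$ ((r - l) mod m, (r - l) div m)
       else \<rho> $$ ((r - l) mod m * n + (c - l) mod n, (r - l) div m * n + (c - l) div n))"
proof -
  have "r - l < m * m" if "\<not> r < l" using assms that by auto
  moreover have "c - l < n * n" if "\<not> c < l" using assms that by auto
  ultimately show ?thesis
    using assms div_mod_less [of "r - l" m] div_mod_less [of "c - l" n]
    by (auto simp: M_mat_def realign_def rep_cols_def ptrace_A_def ptrace_B_def vectorize_def
        block_def mat_of_cols_index mat_of_rows_index index_mat_four_block)
qed

text \<open>Three blocks are linear in the state. The constant block is reproduced because the
  weights sum to 1.\<close>

lemma M_mat_ensemble:
  assumes E: "is_ensemble (m * n) \<rho> q p \<phi>" and rc: "r < l + m * m" "c < l + n * n"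
  shows "M_mat m n l \<alpha> \<beta> \<rho> $$ (r, c) =
    (\<Sum>i<q. of_real (p i) * M_mat m n l \<alpha> \<beta> (projector (\<phi> i)) $$ (r, c))"
proof -
  have \<rho>: "\<rho> $$ (a, b) = (\<Sum>i<q. of_real (p i) * projector (\<phi> i) $$ (a, b))"
    if "a < m * n" "b < m * n" for a b
    using E that by (simp add: is_ensemble_def)
  have p: "(\<Sum>i<q. of_real (p i) * x) = x" for x :: complex
    using E by (simp add: is_ensemble_def flip: of_real_sum sum_distrib_right)
  have A: "ptrace_A m n \<rho> $$ (k, k') = (\<Sum>i<q. of_real (p i) * ptrace_A m n (projector (\<phi> i)) $$ (k, k'))"
    if "k < n" "k' < n" for k k'
  proof -
    have "ptrace_A m n \<rho> $$ (k, k') =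
      (\<Sum>j<m. \<Sum>i<q. of_real (p i) * projector (\<phi> i) $$ (j * n + k, j * n + k'))"
      using that by (simp add: ptrace_A_index \<rho> pair_index_less)
    then show ?thesis using that by (subst (asm) sum.swap) (simp add: ptrace_A_index sum_distrib_left)
  qed
  have B: "ptrace_B m n \<rho> $$ (j, j') = (\<Sum>i<q. of_real (p i) * ptrace_B m n (projector (\<phi> i)) $$ (j, j'))"
    if "j < m" "j' < m" for j j'
  proof -
    have "ptrace_B m n \<rho> $$ (j, j') =
      (\<Sum>k<n. \<Sum>i<q. of_real (p i) * projector (\<phi> i) $$ (j * n + k, j' * n + k))"
      using that by (simp add: ptrace_B_index \<rho> pair_index_less)
    then show ?thesis using that by (subst (asm) sum.swap) (simp add: ptrace_B_index sum_distrib_left)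
  qed
  have "(r - l) div m < m" "(r - l) mod m < m" if "\<not> r < l"
    using rc that div_mod_less [of "r - l" m] by auto
  moreover have "(c - l) div n < n" "(c - l) mod n < n" if "\<not> c < l"
    using rc that div_mod_less [of "c - l" n] by auto
  ultimately show ?thesis
    by (cases "r < l"; cases "c < l"; simp add: M_mat_index [OF rc] A B \<rho> pair_index_less p;
        simp add: sum_distrib_left mult.left_commute)
qed

text \<open>One definition serves both sides: rows with \<open>e\<close> and \<alpha>, columns with
  the second Schmidt vectors and \<beta>. For \<open>t\<close> and \<open>u\<close> distinct the
  first \<open>l\<close> entries are padded with 0.\<close>

definition ext_vec ::
    "nat \<Rightarrow> nat \<Rightarrow> real \<Rightarrow> (nat \<Rightarrow> nat \<Rightarrow> complex) \<Rightarrow> nat \<Rightarrow> nat \<Rightarrow> nat \<Rightarrow> complex" where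
  "ext_vec l m a e t u = (\<lambda>r. if r < l then (if t = u then of_real a else 0)
     else e t ((r - l) mod m) * cnj (e u ((r - l) div m)))"

lemma nrm_ext_vec:
  assumes e: "orthonormal m k e" and tu: "t < k" "u < k"
  shows "nrm (l + m * m) (ext_vec l m a e t u) = (if t = u then sqrt (real l * a\<^sup>2 + 1) else 1)"
proof -
  have one: "(\<Sum>i<m. (cmod (e t i))\<^sup>2) = 1" if "t < k" for t
    using nrm_orthonormal [OF e that] by (simp flip: nrm_sq)
  have "(\<Sum>x<m * m. (cmod (e t (x mod m) * cnj (e u (x div m))))\<^sup>2) =
      (\<Sum>j<m. \<Sum>i<m. (cmod (e u j))\<^sup>2 * (cmod (e t i))\<^sup>2)"
    unfolding sum_pair_index
    by (intro sum.cong refl) (auto simp: norm_mult power_mult_distrib)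
  also have "\<dots> = 1"
    using one tu by (simp flip: sum_distrib_left)
  finally have "(nrm (l + m * m) (ext_vec l m a e t u))\<^sup>2 = (if t = u then real l * a\<^sup>2 else 0) + 1"
    unfolding nrm_sq sum_lessThan_add by (simp add: ext_vec_def)
  from real_sqrt_unique [OF this nrm_nonneg] show ?thesis
    by (auto split: if_splits)
qed

text \<open>Needed for the Schmidt coefficients, for their squares, and for the constant 1, where it
  counts the ordered pairs.\<close>

lemma sum_off_diagonal:
  fixes h :: "nat \<Rightarrow> real"
  shows "(\<Sum>(t, u)\<in>{..<q} \<times> {..<q} - Id. h t * h u) = (\<Sum>t<q. h t)\<^sup>2 - (\<Sum>t<q. (h t)\<^sup>2)"
proof -
  have "(\<Sum>t<q. h t)\<^sup>2 = (\<Sum>(t, u)\<in>{..<q} \<times> {..<q}. h t * h u)"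
    by (simp add: power2_eq_square sum_product sum.cartesian_product)
  also have "\<dots> = (\<Sum>(t, u)\<in>{..<q} \<times> {..<q} - Id. h t * h u) +
      (\<Sum>(t, u)\<in>{..<q} \<times> {..<q} \<inter> Id. h t * h u)"
    by (subst sum.union_disjoint [symmetric]) (auto simp: Un_Int_distrib intro!: sum.cong)
  also have "{..<q} \<times> {..<q} \<inter> Id = (\<lambda>t. (t, t)) ` {..<q}" by auto
  also have "(\<Sum>(t, u)\<in>(\<lambda>t. (t, t)) ` {..<q}. h t * h u) = (\<Sum>t<q. (h t)\<^sup>2)"
    by (subst sum.reindex) (auto simp: inj_on_def power2_eq_square)
  finally show ?thesis by simp
qed

text \<open>The last root contains 1 minus the purity of the reduced state, which is the sum of the
  squared off-diagonal products. Cauchy-Schwarz compares these products with the constant 1.\<close>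

lemma purity_bound:
  fixes s :: "nat \<Rightarrow> real"
  assumes s: "\<And>t. t < q \<Longrightarrow> s t > 0" and one: "(\<Sum>t<q. (s t)\<^sup>2) = 1"
  shows "(\<Sum>t<q. s t)\<^sup>2 - 1 \<le> sqrt (real q * (real q - 1)) * sqrt (1 - (\<Sum>t<q. (s t) ^ 4))"
proof -
  let ?T = "{..<q} \<times> {..<q} - Id"
  let ?h = "\<lambda>(t, u). s t * s u"
  have c: "(\<Sum>x\<in>?T. 1 :: real) = real q * (real q - 1)"
    using sum_off_diagonal [of "\<lambda>_. 1" q] by (simp add: split_def power2_eq_square algebra_simps)
  have "(\<Sum>t<q. s t)\<^sup>2 - 1 = (\<Sum>x\<in>?T. ?h x)"
    using sum_off_diagonal [of s q] one by simp
  also have "\<dots> = (\<Sum>x\<in>?T. \<bar>?h x\<bar> * \<bar>1\<bar>)"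
    using s by (intro sum.cong) (auto simp: less_imp_le)
  also have "\<dots> \<le> L2_set ?h ?T * L2_set (\<lambda>_. 1) ?T"
    by (rule L2_set_mult_ineq)
  also have "L2_set (\<lambda>_. 1) ?T = sqrt (real q * (real q - 1))"
    unfolding L2_set_def c [symmetric] by simp
  also have "L2_set ?h ?T = sqrt (1 - (\<Sum>t<q. (s t) ^ 4))"
  proof -
    have "(\<Sum>x\<in>?T. (?h x)\<^sup>2) = (\<Sum>(t, u)\<in>?T. (s t)\<^sup>2 * (s u)\<^sup>2)"
      by (intro sum.cong) (auto simp: power_mult_distrib)
    also have "\<dots> = 1 - (\<Sum>t<q. (s t) ^ 4)"
      unfolding sum_off_diagonal one by (simp flip: power_mult)
    finally show ?thesis by (simp add: L2_set_def)
  qed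
  finally show ?thesis by (simp add: mult.commute)
qed

section \<open>Pure states in Schmidt form\<close>

lemma projector_index:
  "a < dim_vec \<phi> \<Longrightarrow> b < dim_vec \<phi> \<Longrightarrow> projector \<phi> $$ (a, b) = \<phi> $ a * cnj (\<phi> $ b)"
  by (simp add: projector_def)

text \<open>A singular value decomposition of the \<open>m \<times> n\<close> matrix of amplitudes is a Schmidt
  decomposition of the state.\<close>
context
  fixes m n q :: nat and \<phi> :: "complex vec" and s :: "nat \<Rightarrow> real" and e f :: "nat \<Rightarrow> nat \<Rightarrow> complex"
  assumes pure: "pure_state (m * n) \<phi>"
    and schmidt: "is_svd m n (\<lambda>i k. \<phi> $ (i * n + k)) q s e f"
begin

text \<open>The decomposition of the amplitude matrix conjugates its right vectors, whereas a tensor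
  product does not. The second Schmidt vectors are therefore the conjugates.\<close>

private abbreviation g where "g t k \<equiv> cnj (f t k)"

private lemma dim_state: "dim_vec \<phi> = m * n"
  using pure by (auto simp: pure_state_def)

private lemma e_orthonormal: "orthonormal m q e"
  and g_orthonormal: "orthonormal n q g"
  and s_pos: "t < q \<Longrightarrow> s t > 0"
  using is_svdD [OF schmidt] orthonormal_cnj by auto

private lemma amplitude: "i < m \<Longrightarrow> k < n \<Longrightarrow> \<phi> $ (i * n + k) = (\<Sum>t<q. of_real (s t) * e t i * g t k)"
  by (rule is_svdD(4) [OF schmidt])

private lemma projector_schmidt:
  assumes "i < m" "k < n" "j < m" "k' < n"
  shows "projector \<phi> $$ (i * n + k, j * n + k') =
    (\<Sum>t<q. of_real (s t) * e t i * g t k) * cnj (\<Sum>t<q. of_real (s t) * e t j * g t k')"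
  using assms by (simp only: projector_index dim_state pair_index_less amplitude)

text \<open>The partial trace forms inner products of the \<open>g t\<close>, so the cross terms
  disappear.\<close>

private lemma reduced_B:
  assumes "i < m" "j < m"
  shows "ptrace_B m n (projector \<phi>) $$ (i, j) = (\<Sum>t<q. of_real ((s t)\<^sup>2) * e t i * cnj (e t j))"
proof -
  have "ptrace_B m n (projector \<phi>) $$ (i, j) =
    ip n (\<lambda>k. \<Sum>t<q. (of_real (s t) * e t i) * g t k) (\<lambda>k. \<Sum>t<q. (of_real (s t) * e t j) * g t k)"
    using assms by (simp add: ptrace_B_index projector_schmidt ip_def del: cnj_sum)
  also have "\<dots> = (\<Sum>t<q. (of_real (s t) * e t i) * cnj (of_real (s t) * e t j))"
    by (rule orthonormal_sum_ip [OF g_orthonormal])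
  finally show ?thesis by (simp add: power2_eq_square algebra_simps)
qed

private lemma reduced_A:
  assumes "k < n" "k' < n"
  shows "ptrace_A m n (projector \<phi>) $$ (k, k') = (\<Sum>t<q. of_real ((s t)\<^sup>2) * g t k * cnj (g t k'))"
proof -
  have "ptrace_A m n (projector \<phi>) $$ (k, k') =
    (\<Sum>i<m. (\<Sum>t<q. of_real (s t) * e t i * g t k) * cnj (\<Sum>t<q. of_real (s t) * e t i * g t k'))"
    using assms by (simp add: ptrace_A_index projector_schmidt del: cnj_sum)
  also have "\<dots> = ip m (\<lambda>i. \<Sum>t<q. (of_real (s t) * g t k) * e t i) (\<lambda>i. \<Sum>t<q. (of_real (s t) * g t k') * e t i)"
    by (simp add: ip_def ac_simps del: cnj_sum)
  also have "\<dots> = (\<Sum>t<q. (of_real (s t) * g t k) * cnj (of_real (s t) * g t k'))"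
    by (rule orthonormal_sum_ip [OF e_orthonormal])
  finally show ?thesis by (simp add: power2_eq_square algebra_simps)
qed

text \<open>The weights are general because both squares (normalisation) and fourth powers (purity)
  of the \<open>s t\<close> occur.\<close>

private lemma sum_reduced_B:
  "(\<Sum>i<m. \<Sum>t<q. of_real (c t) * e t i * cnj (e t i)) = complex_of_real (\<Sum>t<q. c t)"
proof -
  have "(\<Sum>i<m. \<Sum>t<q. of_real (c t) * e t i * cnj (e t i)) = (\<Sum>t<q. of_real (c t) * ip m (e t) (e t))"
    by (subst sum.swap) (simp add: ip_def sum_distrib_left mult.assoc)
  then show ?thesis using e_orthonormal by (simp add: orthonormalD)
qed

private lemma schmidt_sum: "(\<Sum>t<q. (s t)\<^sup>2) = 1"
proof -
  have "1 = \<phi> \<bullet>c \<phi>" using pure by (simp add: pure_state_def)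
  also have "\<dots> = (\<Sum>i<m. \<Sum>k<n. projector \<phi> $$ (i * n + k, i * n + k))"
    by (simp add: scalar_prod_def atLeast0LessThan dim_state sum_pair_index projector_index pair_index_less)
  also have "\<dots> = (\<Sum>i<m. ptrace_B m n (projector \<phi>) $$ (i, i))"
    by (simp add: ptrace_B_index)
  also have "\<dots> = (\<Sum>i<m. \<Sum>t<q. of_real ((s t)\<^sup>2) * e t i * cnj (e t i))"
    by (simp add: reduced_B)
  also have "\<dots> = of_real (\<Sum>t<q. (s t)\<^sup>2)" by (rule sum_reduced_B)
  finally show ?thesis by (metis of_real_eq_1_iff)
qed

text \<open>The reduced state is Hermitian, so its square is a Gram matrix, and
  \<open>gram_sum\<close> with weights \<open>(s t)\<^sup>2\<close> yields fourth powers.\<close>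

private lemma pure_concurrence_schmidt:
  "pure_concurrence m n \<phi> = sqrt (2 * (1 - (\<Sum>t<q. (s t) ^ 4)))"
proof -
  let ?R = "ptrace_B m n (projector \<phi>)"
  have R: "?R \<in> carrier_mat m m" by (simp add: ptrace_B_def)
  have h: "?R $$ (a, c) = cnj (?R $$ (c, a))" if "a < m" "c < m" for a c
    using that by (simp add: reduced_B algebra_simps)
  have "mat_trace (?R * ?R) = (\<Sum>a<m. \<Sum>c<m. ?R $$ (a, c) * ?R $$ (c, a))"
    using R by (simp add: mat_trace_def scalar_prod_def atLeast0LessThan)
  also have "\<dots> = (\<Sum>a<m. \<Sum>c<m. cnj (?R $$ (c, a)) * ?R $$ (c, a))"
    by (intro sum.cong refl arg_cong2 [of _ _ _ _ "(*)"] h) auto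
  also have "\<dots> = (\<Sum>a<m. \<Sum>t<q. of_real (((s t)\<^sup>2)\<^sup>2) * e t a * cnj (e t a))"
  proof (rule sum.cong [OF refl])
    fix a assume "a \<in> {..<m}"
    then show "(\<Sum>c<m. cnj (?R $$ (c, a)) * ?R $$ (c, a)) =
        (\<Sum>t<q. of_real (((s t)\<^sup>2)\<^sup>2) * e t a * cnj (e t a))"
      unfolding gram_sum [OF e_orthonormal, of "\<lambda>t. (s t)\<^sup>2" e a a, symmetric]
      by (intro sum.cong refl) (simp only: reduced_B lessThan_iff)
  qed
  also have "\<dots> = of_real (\<Sum>t<q. (s t) ^ 4)"
    unfolding sum_reduced_B by (simp flip: power_mult)
  finally show ?thesis by (simp add: pure_concurrence_def)
qed

text \<open>This is why the extra entries sit at \<open>t = u\<close> only: the reduced states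
  contain no cross terms, and the constant block is \<alpha>\<beta> times the sum of the
  \<open>(s t)\<^sup>2\<close>, which is 1. The realigned block is an amplitude times a conjugated
  amplitude and uses all pairs.\<close>

private lemma M_mat_schmidt:
  assumes "r < l + m * m" "c < l + n * n"
  shows "M_mat m n l \<alpha> \<beta> (projector \<phi>) $$ (r, c) =
    (\<Sum>t<q. \<Sum>u<q. of_real (s t * s u) * ext_vec l m \<alpha> e t u r * ext_vec l n \<beta> g t u c)"
proof -
  have diag: "(\<Sum>t<q. \<Sum>u<q. if t = u then h t u else 0) = (\<Sum>t<q. h t t)" for h :: "nat \<Rightarrow> nat \<Rightarrow> complex"
    by simp
  have r: "(r - l) div m < m" "(r - l) mod m < m" if "\<not> r < l"
    using assms that div_mod_less [of "r - l" m] by auto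
  have c: "(c - l) div n < n" "(c - l) mod n < n" if "\<not> c < l"
    using assms that div_mod_less [of "c - l" n] by auto
  consider "r < l" "c < l" | "r < l" "\<not> c < l" | "\<not> r < l" "c < l" | "\<not> r < l" "\<not> c < l"
    by blast
  then show ?thesis
  proof cases
    case 1
    have "(\<Sum>t<q. \<Sum>u<q. of_real (s t * s u) * ext_vec l m \<alpha> e t u r * ext_vec l n \<beta> g t u c) =
      (\<Sum>t<q. \<Sum>u<q. if t = u then of_real (s t * s u) * of_real (\<alpha> * \<beta>) else 0)"
      using 1 by (intro sum.cong refl) (auto simp: ext_vec_def)
    also have "\<dots> = of_real (\<Sum>t<q. (s t)\<^sup>2) * of_real (\<alpha> * \<beta>)"
      unfolding diag of_real_sum sum_distrib_right by (simp add: power2_eq_square)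
    finally show ?thesis using 1 assms by (simp add: M_mat_index schmidt_sum)
  next
    case 2
    have "(\<Sum>t<q. \<Sum>u<q. of_real (s t * s u) * ext_vec l m \<alpha> e t u r * ext_vec l n \<beta> g t u c) =
      (\<Sum>t<q. \<Sum>u<q. if t = u then of_real (s t * s u) * (of_real \<alpha> *
        (g t ((c - l) mod n) * cnj (g u ((c - l) div n)))) else 0)"
      using 2 by (intro sum.cong refl) (auto simp: ext_vec_def)
    then show ?thesis
      using 2 assms c unfolding diag
      by (simp add: M_mat_index reduced_A sum_distrib_left power2_eq_square algebra_simps)
  next
    case 3
    have "(\<Sum>t<q. \<Sum>u<q. of_real (s t * s u) * ext_vec l m \<alpha> e t u r * ext_vec l n \<beta> g t u c) =
      (\<Sum>t<q. \<Sum>u<q. if t = u then of_real (s t * s u) * (of_real \<beta> *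
        (e t ((r - l) mod m) * cnj (e u ((r - l) div m)))) else 0)"
      using 3 by (intro sum.cong refl) (auto simp: ext_vec_def)
    then show ?thesis
      using 3 assms r unfolding diag
      by (simp add: M_mat_index reduced_B sum_distrib_left power2_eq_square algebra_simps)
  next
    case 4
    have "M_mat m n l \<alpha> \<beta> (projector \<phi>) $$ (r, c) =
      (\<Sum>t<q. of_real (s t) * e t ((r - l) mod m) * g t ((c - l) mod n)) *
      cnj (\<Sum>u<q. of_real (s u) * e u ((r - l) div m) * g u ((c - l) div n))"
      using 4 assms r c by (simp add: M_mat_index projector_schmidt del: cnj_sum)
    then show ?thesis
      using 4 by (simp add: sum_product ext_vec_def algebra_simps)
  qed
qed

private lemma trace_norm_M_mat_schmidt:
  "trace_norm (M_mat m n l \<alpha> \<beta> (projector \<phi>)) \<le>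
    sqrt ((real l * \<alpha>\<^sup>2 + 1) * (real l * \<beta>\<^sup>2 + 1)) + ((\<Sum>t<q. s t)\<^sup>2 - 1)"
proof -
  let ?c = "sqrt ((real l * \<alpha>\<^sup>2 + 1) * (real l * \<beta>\<^sup>2 + 1))"
  let ?T = "{..<q} \<times> {..<q}"
  let ?x = "\<lambda>(t, u) r. of_real (s t * s u) * ext_vec l m \<alpha> e t u r"
  let ?y = "\<lambda>(t, u). ext_vec l n \<beta> g t u"
  \<comment> \<open>Off-diagonal pairs have norm product \<open>s t * s u\<close>. Writing the
    diagonal factor \<open>?c\<close> as 1 + (\<open>?c\<close> - 1) lets the ones add up to the
    full square of the sum.\<close>
  have key: "nrm (l + m * m) (\<lambda>r. of_real (s t * s u) * ext_vec l m \<alpha> e t u r) *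
      nrm (l + n * n) (ext_vec l n \<beta> g t u) =
    s t * s u + (if t = u then (?c - 1) * (s t * s u) else 0)" if "t < q" "u < q" for t u
    using that s_pos [of t] s_pos [of u] unfolding real_sqrt_mult
    by (simp add: nrm_scale nrm_ext_vec [OF e_orthonormal] nrm_ext_vec [OF g_orthonormal] algebra_simps del: of_real_mult)
  have "trace_norm (M_mat m n l \<alpha> \<beta> (projector \<phi>)) \<le>
      (\<Sum>x\<in>?T. nrm (l + m * m) (?x x) * nrm (l + n * n) (?y x))"
    by (rule trace_norm_le [OF M_mat_carrier])
      (simp add: M_mat_schmidt sum.cartesian_product split_def)
  also have "\<dots> = (\<Sum>t<q. \<Sum>u<q. s t * s u + (if t = u then (?c - 1) * (s t * s u) else 0))"
    unfolding sum.cartesian_product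
    by (intro sum.cong refl) (clarsimp simp only: mem_Sigma_iff lessThan_iff prod.case key)
  also have "\<dots> = (\<Sum>t<q. s t)\<^sup>2 + (?c - 1) * (\<Sum>t<q. (s t)\<^sup>2)"
    unfolding power2_eq_square sum_product by (simp add: sum.distrib sum_distrib_left)
  finally show ?thesis by (simp add: schmidt_sum)
qed

lemma trace_norm_le_pure_concurrence_schmidt:
  "sqrt 2 * (trace_norm (M_mat m n l \<alpha> \<beta> (projector \<phi>)) -
      sqrt ((real l * \<alpha>\<^sup>2 + 1) * (real l * \<beta>\<^sup>2 + 1))) \<le>
    sqrt (real (min m n) * (real (min m n) - 1)) * pure_concurrence m n \<phi>"
proof -
  let ?d = "min m n"
  have q: "q \<le> ?d" using orthonormal_le [OF e_orthonormal] orthonormal_le [OF g_orthonormal] by simp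
  have "real q * (real q - 1) \<le> real ?d * (real ?d - 1)"
  \<comment> \<open>\<open>mult_mono\<close> needs \<open>real q - 1\<close> to be nonnegative,
    which fails for \<open>q = 0\<close>.\<close>
  proof (cases "q = 0")
    case True
    then show ?thesis by (cases "?d = 0") auto
  next
    case False
    then show ?thesis using q by (intro mult_mono) auto
  qed
  \<comment> \<open>\<open>sqrt\<close> is negative at negative arguments, so the sign of 1 minus
    the purity must be known before multiplying by its root.\<close>
  moreover have "(\<Sum>t<q. (s t) ^ 4) \<le> (\<Sum>t<q. (s t)\<^sup>2)"
  proof (rule sum_mono)
    fix t assume t: "t \<in> {..<q}"
    then have "(s t)\<^sup>2 \<le> (\<Sum>t<q. (s t)\<^sup>2)" by (intro member_le_sum) auto
    then have "(s t)\<^sup>2 * (s t)\<^sup>2 \<le> 1 * (s t)\<^sup>2"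
      by (intro mult_right_mono) (auto simp: schmidt_sum)
    then show "(s t) ^ 4 \<le> (s t)\<^sup>2" by (simp flip: power_add)
  qed
  ultimately have "sqrt (real q * (real q - 1)) * sqrt (1 - (\<Sum>t<q. (s t) ^ 4)) \<le>
      sqrt (real ?d * (real ?d - 1)) * sqrt (1 - (\<Sum>t<q. (s t) ^ 4))"
    by (intro mult_right_mono real_sqrt_le_mono) (auto simp: schmidt_sum)
  then have "trace_norm (M_mat m n l \<alpha> \<beta> (projector \<phi>)) -
        sqrt ((real l * \<alpha>\<^sup>2 + 1) * (real l * \<beta>\<^sup>2 + 1)) \<le>
      sqrt (real ?d * (real ?d - 1)) * sqrt (1 - (\<Sum>t<q. (s t) ^ 4))"
    using trace_norm_M_mat_schmidt [of l \<alpha> \<beta>] purity_bound [of q s] s_pos schmidt_sum by fastforce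
  then have "sqrt 2 * (trace_norm (M_mat m n l \<alpha> \<beta> (projector \<phi>)) -
        sqrt ((real l * \<alpha>\<^sup>2 + 1) * (real l * \<beta>\<^sup>2 + 1))) \<le>
      sqrt 2 * (sqrt (real ?d * (real ?d - 1)) * sqrt (1 - (\<Sum>t<q. (s t) ^ 4)))"
    by (intro mult_left_mono) auto
  then show ?thesis
    unfolding pure_concurrence_schmidt real_sqrt_mult [of 2] by (simp only: mult_ac)
qed

end

lemma trace_norm_le_pure_concurrence:
  assumes "pure_state (m * n) \<phi>"
  shows "sqrt 2 * (trace_norm (M_mat m n l \<alpha> \<beta> (projector \<phi>)) -
      sqrt ((real l * \<alpha>\<^sup>2 + 1) * (real l * \<beta>\<^sup>2 + 1))) \<le>
    sqrt (real (min m n) * (real (min m n) - 1)) * pure_concurrence m n \<phi>"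
  using svd_exists trace_norm_le_pure_concurrence_schmidt [OF assms] by blast

section \<open>Ensembles and the passage to mixed states\<close>

lemma density_mat_ensemble:
  assumes "density_mat N \<rho>"
  shows "\<exists>r p \<phi>. is_ensemble N \<rho> r p \<phi>"
proof -
  have carr: "\<rho> \<in> carrier_mat N N" and h: "hermitian N (\<lambda>a b. \<rho> $$ (a, b))"
    and psd: "\<And>u. 0 \<le> Re (ip N (\<lambda>a. \<Sum>b<N. \<rho> $$ (a, b) * u b) u)" and tr: "mat_trace \<rho> = 1"
    using assms by (auto simp: density_mat_def psd_mat_iff)
  obtain k \<mu> f where f: "orthonormal N k f"
    and \<rho>: "\<And>a b. a < N \<Longrightarrow> b < N \<Longrightarrow> \<rho> $$ (a, b) = (\<Sum>i<k. of_real (\<mu> i) * f i a * cnj (f i b))"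
    using spectral_decomposition [OF h] by blast
  \<comment> \<open>The eigenvalues serve as probabilities: each is the quadratic form at its
    eigenvector, and the trace condition makes them sum to 1.\<close>
  have nonneg: "\<mu> j \<ge> 0" if j: "j < k" for j
  proof -
    have "ip N (\<lambda>a. \<Sum>b<N. \<rho> $$ (a, b) * f j b) (f j) =
      ip N (\<lambda>a. \<Sum>i<k. (of_real (\<mu> i) * ip N (f j) (f i)) * f i a) (f j)"
    proof (rule ip_cong)
      fix a assume "a < N"
      then show "(\<Sum>b<N. \<rho> $$ (a, b) * f j b) = (\<Sum>i<k. (of_real (\<mu> i) * ip N (f j) (f i)) * f i a)"
        unfolding ip_def sum_distrib_left sum_distrib_right
        by (subst sum.swap) (simp add: \<rho> sum_distrib_left algebra_simps)
    qed simp
    also have "\<dots> = of_real (\<mu> j)"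
      unfolding orthonormal_sum [OF f j] using f j by (simp add: orthonormalD)
    finally show ?thesis using psd [of "f j"] by simp
  qed
  have "1 = (\<Sum>a<N. \<Sum>i<k. of_real (\<mu> i) * f i a * cnj (f i a))"
    using tr carr by (simp add: mat_trace_def \<rho>)
  also have "\<dots> = (\<Sum>i<k. of_real (\<mu> i) * ip N (f i) (f i))"
    by (subst sum.swap) (simp add: ip_def sum_distrib_left mult.assoc)
  also have "\<dots> = of_real (\<Sum>i<k. \<mu> i)"
    using f by (simp add: orthonormalD)
  finally have "(\<Sum>i<k. \<mu> i) = 1" by (metis of_real_eq_1_iff)
  moreover have "pure_state N (vec N (f i))" if "i < k" for i
    using orthonormalD [OF f that that]
    by (simp add: pure_state_def scalar_prod_def atLeast0LessThan ip_def)
  moreover have "\<rho> = mat N N (\<lambda>ab. \<Sum>i<k. of_real (\<mu> i) * projector (vec N (f i)) $$ ab)"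
    using carr by (intro eq_matI) (auto simp: \<rho> projector_def mult.assoc)
  ultimately have "is_ensemble N \<rho> k \<mu> (\<lambda>i. vec N (f i))"
    using nonneg by (simp add: is_ensemble_def)
  then show ?thesis by blast
qed

theorem theorem2:
  fixes dA dB d l :: nat and \<alpha> \<beta> :: real and \<rho> :: "complex mat"
  assumes "dA \<ge> 2" and "dB \<ge> 2" and "d = min dA dB" and "l \<ge> 1"
    and "density_mat (dA * dB) \<rho>"
  shows "concurrence dA dB \<rho> \<ge>
    sqrt 2 / sqrt (real d * (real d - 1)) *
      (trace_norm (M_mat dA dB l \<alpha> \<beta> \<rho>) - sqrt ((real l * \<alpha>\<^sup>2 + 1) * (real l * \<beta>\<^sup>2 + 1)))"
proof -
  let ?M = "M_mat dA dB l \<alpha> \<beta>"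
  let ?c = "sqrt ((real l * \<alpha>\<^sup>2 + 1) * (real l * \<beta>\<^sup>2 + 1))"
  define D where "D = sqrt (real d * (real d - 1))"
  \<comment> \<open>Both dimensions are at least 2, so d(d-1) is positive and division by
    \<open>D\<close> is legitimate.\<close>
  have "D > 0" using assms(1-3) by (simp add: D_def)
  have bound: "sqrt 2 / D * (trace_norm (?M \<rho>) - ?c) \<le> (\<Sum>i<r. p i * pure_concurrence dA dB (\<phi> i))"
    if E: "is_ensemble (dA * dB) \<rho> r p \<phi>" for r p \<phi>
  proof -
    have p: "\<And>i. i < r \<Longrightarrow> 0 \<le> p i" and \<phi>: "\<And>i. i < r \<Longrightarrow> pure_state (dA * dB) (\<phi> i)"
      and one: "(\<Sum>i<r. p i) = 1"
      using E by (auto simp: is_ensemble_def)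
    have "trace_norm (?M \<rho>) \<le> (\<Sum>i<r. p i * trace_norm (?M (projector (\<phi> i))))"
      by (rule trace_norm_convex [OF M_mat_carrier p M_mat_carrier M_mat_ensemble [OF E]])
    \<comment> \<open>The constant \<open>?c\<close> can be moved inside the average because the
      weights sum to 1.\<close>
    also have "\<dots> = (\<Sum>i<r. p i * (trace_norm (?M (projector (\<phi> i))) - ?c)) + ?c"
      using one by (simp add: right_diff_distrib sum_subtractf flip: sum_distrib_right)
    finally have "sqrt 2 * (trace_norm (?M \<rho>) - ?c) \<le>
        sqrt 2 * (\<Sum>i<r. p i * (trace_norm (?M (projector (\<phi> i))) - ?c))"
      by simp
    also have "\<dots> = (\<Sum>i<r. p i * (sqrt 2 * (trace_norm (?M (projector (\<phi> i))) - ?c)))"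
      by (simp add: sum_distrib_left mult.left_commute)
    also have "\<dots> \<le> (\<Sum>i<r. p i * (D * pure_concurrence dA dB (\<phi> i)))"
      unfolding D_def assms(3)
      by (intro sum_mono mult_left_mono trace_norm_le_pure_concurrence) (auto simp: p \<phi>)
    also have "\<dots> = D * (\<Sum>i<r. p i * pure_concurrence dA dB (\<phi> i))"
      by (simp add: sum_distrib_left mult.left_commute)
    finally show ?thesis using \<open>D > 0\<close> by (simp add: pos_divide_le_eq mult.commute)
  qed
  show ?thesis
    unfolding concurrence_def D_def [symmetric]
    \<comment> \<open>A common lower bound of all ensemble averages is below their infimum because
      the spectral ensemble makes the set nonempty.\<close>
    using density_mat_ensemble [OF assms(5)] bound by (intro cInf_greatest) blast+
qed

end
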